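(* Let $H$ be a separable complex Hilbert space, $A$ a strictly positive selfadjoint operator on $H$, and $f:\sigma(A)\to[0,\infty)$ a continuous function. Let $S(t)=e^{t\mathbb{A}}$ be the contraction semigroup on $\mathcal{H}=H^1\times H$ generated by the operator $\mathbb{A}(u,v)=(v,-Au-f(A)v)$ defined in the context. Then $S(t)$ is exponentially stable if and only if $$\inf_{s\in\sigma(A)}f(s)>0\qquad\text{and}\qquad\sup_{s\in\sigma(A)}\frac{f(s)}{s}<\infty .$$
   Context: $(H,\langle\cdot,\cdot\rangle,\|\cdot\|)$ is a separable complex Hilbert space and $A:\mathrm{dom}(A)\subset H\to H$ is a strictly positive selfadjoint linear operator (so $\sigma(A)$ is a nonempty closed subset of $(0,\infty)$; $A$ may be bounded or unbounded and $A^{-1}$ is not necessarily compact). $f:\sigma(A)\to[0,\infty)$ is continuous, and $f(A)=\int_{\sigma(A)}f(s)\,dE_A(s)$ is the selfadjoint operator given by the functional calculus, $E_A$ being the spectral measure of $A$. For $r>0$, $H^r=\mathrm{dom}(A^{r/2})$ with norm $\|u\|_r=\|A^{r/2}u\|$. The phase space is $\mathcal{H}=H^1\times H$ with norm $\|(u,v)\|_{\mathcal{H}}^2=\|u\|_1^2+\|v\|^2$. The operator $\mathbb{A}$ is $\mathbb{A}(u,v)=(v,\,-(Au+f(A)v))$ with domain $\mathrm{dom}(\mathbb{A})=\{(u,v)\in\mathcal{H}: v\in H^1,\ Au+f(A)v\in H\}$. Here, when $u\notin\mathrm{dom}(A)$ or $v\notin\mathrm{dom}(f(A))$, $Au$ and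 $f(A)v$ are understood by duality, as the functionals $w\mapsto\langle Aw,u\rangle$ on $\mathrm{dom}(A)$ and $w\mapsto\langle f(A)w,v\rangle$ on $\mathrm{dom}(f(A))$; thus $Au+f(A)v\in H$ means that there is $h\in H$ (then denoted $Au+f(A)v$) with $\langle Aw,u\rangle+\langle f(A)w,v\rangle=\langle w,h\rangle$ for all $w\in\mathrm{dom}(A)\cap\mathrm{dom}(f(A))$. The operator $\mathbb{A}$ generates a strongly continuous contraction semigroup $S(t)=e^{t\mathbb{A}}$ on $\mathcal{H}$. $S(t)$ is called exponentially stable if there exist $\varkappa>0$ and $M\ge1$ such that $\|S(t)z_0\|_{\mathcal{H}}\le Me^{-\varkappa t}\|z_0\|_{\mathcal{H}}$ for all $z_0\in\mathcal{H}$ and all $t\ge0$. *)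

theory Defs
  imports "HOL-Analysis.Analysis"
begin

section \<open>Complex Hilbert spaces\<close>

class complex_vector = real_vector +
  fixes scaleC :: "complex \<Rightarrow> 'a \<Rightarrow> 'a"  (infixr "*\<^sub>C" 75)
  assumes scaleC_add_right: "c *\<^sub>C (x + y) = c *\<^sub>C x + c *\<^sub>C y"
    and scaleC_add_left: "(c + d) *\<^sub>C x = c *\<^sub>C x + d *\<^sub>C x"
    and scaleC_scaleC: "c *\<^sub>C (d *\<^sub>C x) = (c * d) *\<^sub>C x"
    and scaleC_of_real: "complex_of_real r *\<^sub>C x = r *\<^sub>R x"

instantiation prod :: (complex_vector, complex_vector) complex_vector
begin

definition scaleC_prod_def: "c *\<^sub>C z = (c *\<^sub>C fst z, c *\<^sub>C snd z)"

instance
  by standard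
    (auto simp: scaleC_prod_def scaleC_add_right scaleC_add_left scaleC_scaleC scaleC_of_real
      scaleR_prod_def)

end

text \<open>The inner product is linear in its first argument.\<close>

class complex_inner = complex_vector + real_normed_vector +
  fixes cinner :: "'a \<Rightarrow> 'a \<Rightarrow> complex"
  assumes cinner_commute: "cinner x y = cnj (cinner y x)"
    and cinner_add_left: "cinner (x + y) z = cinner x z + cinner y z"
    and cinner_scaleC_left: "cinner (c *\<^sub>C x) y = c * cinner x y"
    and norm_eq_sqrt_cinner: "norm x = sqrt (Re (cinner x x))"

class chilbert_space = complex_inner + banach

definition csubspace :: "'a::complex_vector set \<Rightarrow> bool" where
  "csubspace X \<longleftrightarrow> 0 \<in> X \<and> (\<forall>x\<in>X. \<forall>y\<in>X. x + y \<in> X) \<and> (\<forall>c. \<forall>x\<in>X. c *\<^sub>C x \<in> X)"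

definition clinear_on :: "'a::complex_vector set \<Rightarrow> ('a \<Rightarrow> 'b::complex_vector) \<Rightarrow> bool" where
  "clinear_on X T \<longleftrightarrow> csubspace X \<and>
     (\<forall>x\<in>X. \<forall>y\<in>X. T (x + y) = T x + T y) \<and> (\<forall>c. \<forall>x\<in>X. T (c *\<^sub>C x) = c *\<^sub>C T x)"


section \<open>Unbounded operators\<close>

text \<open>
  An operator with domain contained in a space is a partial map, so that equality of operators
  includes equality of their domains.
\<close>

definition linear_operator :: "('a::complex_vector \<rightharpoonup> 'b::complex_vector) \<Rightarrow> bool" where
  "linear_operator T \<longleftrightarrow> clinear_on (dom T) (\<lambda>x. the (T x))"

definition adjoint_op :: "('h::complex_inner \<rightharpoonup> 'h) \<Rightarrow> ('h \<rightharpoonup> 'h)" where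
  "adjoint_op T = (\<lambda>v.
     if \<exists>h. \<forall>w\<in>dom T. cinner (the (T w)) v = cinner w h
     then Some (THE h. \<forall>w\<in>dom T. cinner (the (T w)) v = cinner w h)
     else None)"

definition selfadjoint_op :: "('h::complex_inner \<rightharpoonup> 'h) \<Rightarrow> bool" where
  "selfadjoint_op T \<longleftrightarrow> linear_operator T \<and> closure (dom T) = UNIV \<and> adjoint_op T = T"

definition strictly_positive_op :: "('h::complex_inner \<rightharpoonup> 'h) \<Rightarrow> bool" where
  "strictly_positive_op T \<longleftrightarrow>
     (\<exists>c>0. \<forall>x\<in>dom T. c * (norm x)\<^sup>2 \<le> Re (cinner (the (T x)) x))"

definition resolvent_set :: "('h::complex_inner \<rightharpoonup> 'h) \<Rightarrow> complex set" where
  "resolvent_set T = {z. bij_betw (\<lambda>x. the (T x) - z *\<^sub>C x) (dom T) UNIV \<and>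
     (\<exists>C. \<forall>x\<in>dom T. norm x \<le> C * norm (the (T x) - z *\<^sub>C x))}"

definition spectrum :: "('h::complex_inner \<rightharpoonup> 'h) \<Rightarrow> complex set" where
  "spectrum T = - resolvent_set T"

text \<open>For selfadjoint \<open>T\<close> the spectrum is real; this is the spectrum as a set of reals.\<close>

definition real_spectrum :: "('h::complex_inner \<rightharpoonup> 'h) \<Rightarrow> real set" where
  "real_spectrum T = {s. complex_of_real s \<in> spectrum T}"


section \<open>Spectral measures and functional calculus\<close>

definition orthogonal_projection :: "('h::complex_inner \<Rightarrow> 'h) \<Rightarrow> bool" where
  "orthogonal_projection P \<longleftrightarrow> clinear_on UNIV P \<and> (\<forall>x. P (P x) = P x) \<and>
     (\<forall>x y. cinner (P x) y = cinner x (P y))"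

definition projection_valued_measure :: "(real set \<Rightarrow> 'h::complex_inner \<Rightarrow> 'h) \<Rightarrow> bool" where
  "projection_valued_measure E \<longleftrightarrow>
     (\<forall>B\<in>sets borel. orthogonal_projection (E B)) \<and>
     (\<forall>x. E UNIV x = x) \<and>
     (\<forall>B x. range B \<subseteq> sets borel \<longrightarrow> disjoint_family B \<longrightarrow>
        (\<lambda>n::nat. E (B n) x) sums E (\<Union>n. B n) x)"

definition scalar_measure :: "(real set \<Rightarrow> 'h::complex_inner \<Rightarrow> 'h) \<Rightarrow> 'h \<Rightarrow> real measure" where
  "scalar_measure E x = measure_of UNIV (sets borel) (\<lambda>B. ennreal (Re (cinner (E B x) x)))"

text \<open>
  The operator \<open>T = \<integral>\<^sub>S g dE\<close> for real-valued \<open>g\<close>.  Its domain consists of the \<open>x\<close> with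
  \<open>\<integral>\<^sub>S \<bar>g\<bar>\<^sup>2 d\<langle>E x, x\<rangle> < \<infinity>\<close>, and \<open>T x\<close> is determined by \<open>\<langle>T x, z\<rangle> = \<integral>\<^sub>S g d\<langle>E x, z\<rangle>\<close> for \<open>z\<close>
  in the domain.  The integral against the complex measure \<open>\<langle>E x, z\<rangle>\<close> is expressed through the
  positive measures \<open>\<langle>E y, y\<rangle>\<close> by polarization.
\<close>

definition spectral_domain ::
    "(real set \<Rightarrow> 'h::complex_inner \<Rightarrow> 'h) \<Rightarrow> real set \<Rightarrow> (real \<Rightarrow> real) \<Rightarrow> 'h set" where
  "spectral_domain E S g = {x. (\<integral>\<^sup>+s\<in>S. ennreal ((g s)\<^sup>2) \<partial>scalar_measure E x) < \<infinity>}"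

definition spectral_form ::
    "(real set \<Rightarrow> 'h::complex_inner \<Rightarrow> 'h) \<Rightarrow> real set \<Rightarrow> (real \<Rightarrow> real) \<Rightarrow> 'h \<Rightarrow> 'h \<Rightarrow> complex" where
  "spectral_form E S g x z =
     (\<Sum>k<4. \<i> ^ k * complex_of_real (LINT s:S|scalar_measure E (x + \<i> ^ k *\<^sub>C z). g s)) / 4"

definition spectral_integral ::
    "(real set \<Rightarrow> 'h::complex_inner \<Rightarrow> 'h) \<Rightarrow> real set \<Rightarrow> (real \<Rightarrow> real) \<Rightarrow> ('h \<rightharpoonup> 'h)" where
  "spectral_integral E S g = (\<lambda>x.
     if x \<in> spectral_domain E S g
     then Some (THE y. \<forall>z\<in>spectral_domain E S g. cinner y z = spectral_form E S g x z)
     else None)"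

definition is_spectral_measure_of ::
    "(real set \<Rightarrow> 'h::complex_inner \<Rightarrow> 'h) \<Rightarrow> ('h \<rightharpoonup> 'h) \<Rightarrow> bool" where
  "is_spectral_measure_of E T \<longleftrightarrow>
     projection_valued_measure E \<and> T = spectral_integral E UNIV (\<lambda>s. s)"

text \<open>\<open>f(A)\<close>, where \<open>E\<close> is the spectral measure of \<open>A\<close>.\<close>

definition functional_calculus ::
    "('h::complex_inner \<rightharpoonup> 'h) \<Rightarrow> (real set \<Rightarrow> 'h \<Rightarrow> 'h) \<Rightarrow> (real \<Rightarrow> real) \<Rightarrow> ('h \<rightharpoonup> 'h)" where
  "functional_calculus A E f = spectral_integral E (real_spectrum A) f"


section \<open>The damped equation\<close>

definition power_space ::
    "('h::complex_inner \<rightharpoonup> 'h) \<Rightarrow> (real set \<Rightarrow> 'h \<Rightarrow> 'h) \<Rightarrow> real \<Rightarrow> 'h set" where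
  "power_space A E r = dom (functional_calculus A E (\<lambda>s. s powr (r / 2)))"

definition power_norm ::
    "('h::complex_inner \<rightharpoonup> 'h) \<Rightarrow> (real set \<Rightarrow> 'h \<Rightarrow> 'h) \<Rightarrow> real \<Rightarrow> 'h \<Rightarrow> real" where
  "power_norm A E r u = norm (the (functional_calculus A E (\<lambda>s. s powr (r / 2)) u))"

definition phase_space ::
    "('h::complex_inner \<rightharpoonup> 'h) \<Rightarrow> (real set \<Rightarrow> 'h \<Rightarrow> 'h) \<Rightarrow> ('h \<times> 'h) set" where
  "phase_space A E = power_space A E 1 \<times> UNIV"

definition phase_norm ::
    "('h::complex_inner \<rightharpoonup> 'h) \<Rightarrow> (real set \<Rightarrow> 'h \<Rightarrow> 'h) \<Rightarrow> 'h \<times> 'h \<Rightarrow> real" where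
  "phase_norm A E = (\<lambda>(u, v). sqrt ((power_norm A E 1 u)\<^sup>2 + (norm v)\<^sup>2))"

text \<open>\<open>h\<close> represents the functional \<open>B u + C v\<close>, where \<open>B u\<close> and \<open>C v\<close> are understood by duality.\<close>

definition weak_sum ::
    "('h::complex_inner \<rightharpoonup> 'h) \<Rightarrow> ('h \<rightharpoonup> 'h) \<Rightarrow> 'h \<Rightarrow> 'h \<Rightarrow> 'h \<Rightarrow> bool" where
  "weak_sum B C u v h \<longleftrightarrow>
     (\<forall>w\<in>dom B \<inter> dom C. cinner (the (B w)) u + cinner (the (C w)) v = cinner w h)"

definition damped_operator ::
    "('h::complex_inner \<rightharpoonup> 'h) \<Rightarrow> (real set \<Rightarrow> 'h \<Rightarrow> 'h) \<Rightarrow> (real \<Rightarrow> real) \<Rightarrow> ('h \<times> 'h \<rightharpoonup> 'h \<times> 'h)" where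
  "damped_operator A E f = (\<lambda>(u, v).
     if (u, v) \<in> phase_space A E \<and> v \<in> power_space A E 1 \<and>
        (\<exists>h. weak_sum A (functional_calculus A E f) u v h)
     then Some (v, - (THE h. weak_sum A (functional_calculus A E f) u v h))
     else None)"


section \<open>Semigroups on a normed space with carrier \<open>X\<close> and norm \<open>N\<close>\<close>

definition contraction_semigroup ::
    "'z::complex_vector set \<Rightarrow> ('z \<Rightarrow> real) \<Rightarrow> (real \<Rightarrow> 'z \<Rightarrow> 'z) \<Rightarrow> bool" where
  "contraction_semigroup X N S \<longleftrightarrow>
     (\<forall>t\<ge>0. clinear_on X (S t) \<and> S t ` X \<subseteq> X \<and> (\<forall>z\<in>X. N (S t z) \<le> N z)) \<and>
     (\<forall>z\<in>X. S 0 z = z) \<and>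
     (\<forall>t\<ge>0. \<forall>s\<ge>0. \<forall>z\<in>X. S (t + s) z = S t (S s z)) \<and>
     (\<forall>z\<in>X. ((\<lambda>t. N (S t z - z)) \<longlongrightarrow> 0) (at_right 0))"

definition has_generator_value ::
    "'z::complex_vector set \<Rightarrow> ('z \<Rightarrow> real) \<Rightarrow> (real \<Rightarrow> 'z \<Rightarrow> 'z) \<Rightarrow> 'z \<Rightarrow> 'z \<Rightarrow> bool" where
  "has_generator_value X N S z y \<longleftrightarrow> y \<in> X \<and>
     ((\<lambda>t. N ((1 / t) *\<^sub>R (S t z - z) - y)) \<longlongrightarrow> 0) (at_right 0)"

definition generator ::
    "'z::complex_vector set \<Rightarrow> ('z \<Rightarrow> real) \<Rightarrow> (real \<Rightarrow> 'z \<Rightarrow> 'z) \<Rightarrow> ('z \<rightharpoonup> 'z)" where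
  "generator X N S = (\<lambda>z.
     if z \<in> X \<and> (\<exists>y. has_generator_value X N S z y)
     then Some (THE y. has_generator_value X N S z y)
     else None)"

definition exponentially_stable ::
    "'z set \<Rightarrow> ('z \<Rightarrow> real) \<Rightarrow> (real \<Rightarrow> 'z \<Rightarrow> 'z) \<Rightarrow> bool" where
  "exponentially_stable X N S \<longleftrightarrow>
     (\<exists>\<kappa>>0. \<exists>M\<ge>1. \<forall>z\<in>X. \<forall>t\<ge>0. N (S t z) \<le> M * exp (- \<kappa> * t) * N z)"

end

theory Submission
  imports Defs
begin

text \<open>
  Truncating with \<open>P n = E {-n..n}\<close> turns every statement about the unbounded operators into
  one about the bounded functional calculus on the spectrum.

  If the semigroup is exponentially stable, then \<open>\<parallel>z\<parallel> \<le> C \<parallel>(\<AA> - i \<omega>) z\<parallel>\<close> uniformly in real \<open>\<omega>\<close>.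
  Testing this on approximate eigenvectors \<open>w\<close> of \<open>A\<close> at \<open>l\<close>, with \<open>z = (w, i \<surd>l w)\<close> at
  \<open>\<omega> = \<surd>l\<close> and \<open>z = (w, - (l / f l) w)\<close> at \<open>\<omega> = 0\<close>, gives \<open>f l \<ge> 1 / C\<close> and \<open>f l \<le> C l\<close>;
  the second choice is suggested by overdamping, where the slow root of
  \<open>\<mu>\<^sup>2 + f l \<mu> + l = 0\<close> is about \<open>- l / f l\<close>.

  Conversely, if \<open>\<alpha> \<le> f\<close> and \<open>f s \<le> \<beta> s\<close>, then for small \<open>\<epsilon>\<close> the functional
  \<open>\<parallel>(u, v)\<parallel>\<^sup>2 / 2 + \<epsilon> Re \<langle>u, v\<rangle>\<close> is equivalent to the squared energy norm and decays
  exponentially along solutions starting in the domain of the generator, which is dense.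
\<close>

section \<open>Complex inner product spaces\<close>

text \<open>Two obstacles shape the proof. A velocity \<open>v\<close> in the energy space need not
  lie in the domain of \<open>fA\<close>, so neither \<open>A u\<close> nor \<open>fA v\<close>
  alone has to be a vector; products with them are formed after truncation, and only the resulting
  inequality is passed to the limit. The spectrum may be continuous, so test vectors are taken from
  small spectral windows. Why the tests work: up to a vanishing error, at
  \<open>\<omega> = \<surd>l\<close> the stiffness cancels and the image of \<open>z\<close> has
  norm \<open>\<surd>l * f l\<close>, while \<open>z\<close> has norm at least
  \<open>\<surd>l\<close>; at \<open>\<omega> = 0\<close> the image is \<open>(- m w, 0)\<close>
  with \<open>m = l / f l\<close>, of energy norm \<open>m * \<surd>l\<close>. Why the functional
  works: in the derivative of the energy the terms with \<open>A\<close> cancel and only the damping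
  \<open>q = \<langle>fA v, v\<rangle>\<close> is left. The bound \<alpha> on \<open>f\<close> lets
  \<open>q\<close> dominate the norm of \<open>v\<close>. The term
  \<open>\<langle>fA v, u\<rangle>\<close>, which has no sign, is absorbed because the form of
  \<open>fA\<close> is nonnegative at \<open>u + \<beta> v\<close>, where
  \<open>f s \<le> \<beta> s\<close> bounds the \<open>u\<close> part by the potential
  energy.\<close>

lemma scaleC_1 [simp]: "1 *\<^sub>C (x::'a::complex_vector) = x"
  using scaleC_of_real[of 1 x] by simp

lemma scaleC_0_left [simp]: "0 *\<^sub>C (x::'a::complex_vector) = 0"
  using scaleC_of_real[of 0 x] by simp

lemma scaleC_minus_left: "(- c) *\<^sub>C (x::'a::complex_vector) = - (c *\<^sub>C x)"
  using scaleC_add_left[of c "-c" x] by (simp add: add_eq_0_iff)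

lemma scaleC_0_right [simp]: "c *\<^sub>C (0::'a::complex_vector) = 0"
  using scaleC_add_right[of c 0 0] by simp

lemma scaleC_minus_right: "c *\<^sub>C (- (x::'a::complex_vector)) = - (c *\<^sub>C x)"
  using scaleC_add_right[of c x "-x"] by (simp add: add_eq_0_iff)

lemma scaleC_diff_left: "(c - d) *\<^sub>C (x::'a::complex_vector) = c *\<^sub>C x - d *\<^sub>C x"
  using scaleC_add_left[of c "-d" x] by (simp add: scaleC_minus_left)

lemma scaleC_diff_right: "c *\<^sub>C (x - (y::'a::complex_vector)) = c *\<^sub>C x - c *\<^sub>C y"
  using scaleC_add_right[of c x "-y"] by (simp add: scaleC_minus_right)

lemma scaleC_minus1: "(- 1) *\<^sub>C (x::'a::complex_vector) = - x"
  by (simp add: scaleC_minus_left)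

lemma scaleC_scaleR: "c *\<^sub>C (r *\<^sub>R (x::'a::complex_vector)) = r *\<^sub>R (c *\<^sub>C x)"
  by (simp add: scaleC_of_real[symmetric] scaleC_scaleC mult.commute)

lemma cinner_scaleR_left: "cinner (r *\<^sub>R x) y = r * cinner x (y::'a::complex_inner)"
  by (simp add: scaleC_of_real[symmetric] cinner_scaleC_left)

lemma cinner_add_right: "cinner x (y + z) = cinner x y + cinner x (z::'a::complex_inner)"
  by (metis cinner_add_left cinner_commute complex_cnj_add)

lemma cinner_scaleC_right: "cinner x (c *\<^sub>C y) = cnj c * cinner x (y::'a::complex_inner)"
  by (metis cinner_scaleC_left cinner_commute complex_cnj_mult)

lemma cinner_scaleR_right: "cinner x (r *\<^sub>R y) = r * cinner x (y::'a::complex_inner)"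
  by (simp add: scaleC_of_real[symmetric] cinner_scaleC_right)

lemma cinner_self: "cinner x (x::'a::complex_inner) = complex_of_real ((norm x)\<^sup>2)"
proof -
  have "Im (cinner x x) = 0"
    using cinner_commute[of x x] by (metis Im_complex_of_real Reals_cnj_iff complex_is_Real_iff)
  moreover have "Re (cinner x x) \<ge> 0"
    using norm_ge_zero[of x] unfolding norm_eq_sqrt_cinner by simp
  ultimately show ?thesis
    by (simp add: complex_eq_iff norm_eq_sqrt_cinner)
qed

lemma norm_scaleC: "norm (c *\<^sub>C x) = cmod c * norm (x::'a::complex_inner)"
proof -
  have "complex_of_real ((norm (c *\<^sub>C x))\<^sup>2) = (c * cnj c) * cinner x x"
    by (simp only: cinner_self[symmetric] cinner_scaleC_left cinner_scaleC_right mult_ac)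
  also have "\<dots> = complex_of_real ((cmod c * norm x)\<^sup>2)"
    by (simp only: complex_norm_square[symmetric] cinner_self of_real_mult power_mult_distrib of_real_power)
  finally have "complex_of_real ((norm (c *\<^sub>C x))\<^sup>2) = complex_of_real ((cmod c * norm x)\<^sup>2)" .
  then have "(norm (c *\<^sub>C x))\<^sup>2 = (cmod c * norm x)\<^sup>2"
    using of_real_eq_iff by blast
  then show ?thesis by simp
qed

lemma cinner_cauchy_schwarz: "cmod (cinner x y) \<le> norm x * norm (y::'a::complex_inner)"
proof (cases "y = 0")
  case True
  then show ?thesis using cinner_scaleC_right[of x 0 y] by simp
next
  case False
  define c where "c = cinner x y / complex_of_real ((norm y)\<^sup>2)"
  have yx: "cinner y x = cnj (cinner x y)" by (rule cinner_commute)
  have cy: "c * complex_of_real ((norm y)\<^sup>2) = cinner x y" using False by (simp add: c_def)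
  have "complex_of_real ((norm (x + (-c) *\<^sub>C y))\<^sup>2)
      = cinner x x - cnj c * cinner x y - c * cnj (cinner x y) + c * cnj c * cinner y y"
    unfolding cinner_self[symmetric]
    by (simp add: cinner_add_left cinner_add_right cinner_scaleC_left cinner_scaleC_right yx
        algebra_simps)
  also have "\<dots> = cinner x x - c * cnj (cinner x y)"
    by (simp add: cinner_self cy[symmetric] algebra_simps)
  also have "\<dots> = complex_of_real ((norm x)\<^sup>2 - (cmod (cinner x y))\<^sup>2 / (norm y)\<^sup>2)"
    using complex_norm_square[of "cinner x y"] by (simp add: cinner_self c_def)
  finally have "(norm x)\<^sup>2 - (cmod (cinner x y))\<^sup>2 / (norm y)\<^sup>2 \<ge> 0"
    by (metis of_real_eq_iff zero_le_power2)
  then have "(cmod (cinner x y))\<^sup>2 \<le> (norm x * norm y)\<^sup>2"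
    using False by (simp add: field_simps)
  then show ?thesis by (simp add: power2_le_iff_abs_le)
qed

interpretation cinner: bounded_bilinear "cinner :: 'a::complex_inner \<Rightarrow> 'a \<Rightarrow> complex"
proof
  show "\<exists>K. \<forall>a b::'a. cmod (cinner a b) \<le> norm a * norm b * K"
    by (rule exI[of _ 1]) (simp add: cinner_cauchy_schwarz)
qed (simp_all add: cinner_add_left cinner_add_right cinner_scaleR_left cinner_scaleR_right
      scaleR_conv_of_real)

interpretation scaleC: bounded_bilinear "scaleC :: complex \<Rightarrow> 'a::complex_inner \<Rightarrow> 'a"
proof
  show "\<exists>K. \<forall>a. \<forall>b::'a. norm (a *\<^sub>C b) \<le> norm a * norm b * K"
    by (rule exI[of _ 1]) (simp add: norm_scaleC)
qed (simp_all add: scaleC_add_left scaleC_add_right scaleC_scaleR scaleC_of_real[symmetric]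
      scaleC_scaleC scaleR_conv_of_real mult.commute)

lemma cinner_eq_iff: "(\<And>z. cinner x z = cinner y z) \<Longrightarrow> x = (y::'a::complex_inner)"
  using cinner_self[of "x - y"] by (simp add: cinner.diff_left)

section \<open>Projection-valued measures\<close>

lemma orthogonal_projection_norm_square:
  assumes "orthogonal_projection P"
  shows "cinner (P x) x = complex_of_real ((norm (P x))\<^sup>2)"
  by (metis assms cinner_self orthogonal_projection_def)

lemma orthogonal_projection_norm_le:
  assumes "orthogonal_projection P"
  shows "norm (P x) \<le> norm x"
proof -
  have "(norm (P x))\<^sup>2 \<le> norm (P x) * norm x"
    using cinner_cauchy_schwarz[of "P x" x]
    by (simp add: orthogonal_projection_norm_square[OF assms] norm_power)
  then show ?thesis
    by (cases "norm (P x) = 0") (simp_all add: power2_eq_square)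
qed

locale pvm =
  fixes E :: "real set \<Rightarrow> 'h::chilbert_space \<Rightarrow> 'h"
  assumes pvm: "projection_valued_measure E"
begin

lemma proj: "B \<in> sets borel \<Longrightarrow> orthogonal_projection (E B)"
  using pvm by (auto simp: projection_valued_measure_def)

lemma E_UNIV [simp]: "E UNIV x = x"
  using pvm by (auto simp: projection_valued_measure_def)

lemma E_sums: "range B \<subseteq> sets borel \<Longrightarrow> disjoint_family B \<Longrightarrow> (\<lambda>n::nat. E (B n) x) sums E (\<Union>n. B n) x"
  using pvm by (auto simp: projection_valued_measure_def)

lemma E_linear:
  assumes "B \<in> sets borel"
  shows "E B (x + y) = E B x + E B y" "E B (c *\<^sub>C x) = c *\<^sub>C E B x"
    "E B (r *\<^sub>R x) = r *\<^sub>R E B x" "E B 0 = 0"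
proof -
  have "clinear_on UNIV (E B)" using proj[OF assms] by (auto simp: orthogonal_projection_def)
  then show 1: "E B (x + y) = E B x + E B y" and 2: "E B (c *\<^sub>C x) = c *\<^sub>C E B x" for x y c
    by (auto simp: clinear_on_def)
  show "E B (r *\<^sub>R x) = r *\<^sub>R E B x" by (metis 2 scaleC_of_real)
  show "E B 0 = 0" using 1[of 0 0] by simp
qed

lemma E_sym: "B \<in> sets borel \<Longrightarrow> cinner (E B x) y = cinner x (E B y)"
  using proj[of B] by (auto simp: orthogonal_projection_def)

lemma E_idem: "B \<in> sets borel \<Longrightarrow> E B (E B x) = E B x"
  using proj[of B] by (auto simp: orthogonal_projection_def)

lemma E_quad: "B \<in> sets borel \<Longrightarrow> cinner (E B x) x = complex_of_real ((norm (E B x))\<^sup>2)"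
  by (rule orthogonal_projection_norm_square[OF proj])

lemma E_norm_le: "B \<in> sets borel \<Longrightarrow> norm (E B x) \<le> norm x"
  by (rule orthogonal_projection_norm_le[OF proj])

text \<open>Countable additivity on a constant family forces this: a constant series converges only
  if its term is 0.\<close>

lemma E_empty [simp]: "E {} x = 0"
proof -
  have "(\<lambda>n::nat. E {} x) sums E (\<Union>n::nat. {}) x"
    by (rule E_sums) (auto simp: disjoint_family_on_def)
  then have "summable (\<lambda>n::nat. E {} x)" by (rule sums_summable)
  then show ?thesis by (simp add: summable_const_iff)
qed

lemma E_Un:
  assumes "A \<in> sets borel" "B \<in> sets borel" "A \<inter> B = {}"
  shows "E (A \<union> B) x = E A x + E B x"
proof -
  have "(\<lambda>n. E (binaryset A B n) x) sums E (\<Union>n. binaryset A B n) x"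
    using assms by (intro E_sums) (auto simp: binaryset_def disjoint_family_on_def)
  then have 1: "(\<lambda>n. E (binaryset A B n) x) sums E (A \<union> B) x"
    by (simp add: UN_binaryset_eq)
  have "(\<lambda>n. E (binaryset A B n) x) sums (\<Sum>n\<in>{0,1}. E (binaryset A B n) x)"
    by (rule sums_finite) (auto simp: binaryset_def)
  then show ?thesis
    using sums_unique2[OF 1] by (simp add: binaryset_def)
qed

text \<open>Multiplicativity of \<open>E\<close> is derived, starting here. For
  \<open>y = E B x\<close>, additivity of the quadratic form makes the squared norm of
  \<open>E (A \<union> B) y\<close> the sum of those of \<open>E A y\<close> and \<open>y\<close>; a
  projection does not increase the norm, so nothing is left for \<open>E A y\<close>.\<close>

lemma E_disjoint:
  assumes "A \<in> sets borel" "B \<in> sets borel" "A \<inter> B = {}"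
  shows "E A (E B x) = 0"
proof -
  let ?y = "E B x"
  have AB: "A \<union> B \<in> sets borel" using assms by auto
  have "complex_of_real ((norm (E (A \<union> B) ?y))\<^sup>2)
      = complex_of_real ((norm (E A ?y))\<^sup>2 + (norm (E B ?y))\<^sup>2)"
    using E_Un[OF assms, of ?y] E_quad[OF AB, of ?y] E_quad[OF assms(1), of ?y]
      E_quad[OF assms(2), of ?y]
    by (simp add: cinner_add_left)
  then have "(norm (E (A \<union> B) ?y))\<^sup>2 = (norm (E A ?y))\<^sup>2 + (norm (E B ?y))\<^sup>2"
    using of_real_eq_iff by blast
  moreover have "(norm (E (A \<union> B) ?y))\<^sup>2 \<le> (norm ?y)\<^sup>2"
    using E_norm_le[OF AB] by (simp add: power_mono)
  ultimately have "(norm (E A ?y))\<^sup>2 \<le> 0" using E_idem[OF assms(2)] by simp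
  then show ?thesis by simp
qed

text \<open>Both sets are split along \<open>A \<inter> B\<close>; the cross terms vanish by
  \<open>E_disjoint\<close>.\<close>

lemma E_Int:
  assumes A: "A \<in> sets borel" and B: "B \<in> sets borel"
  shows "E A (E B x) = E (A \<inter> B) x"
proof -
  have m: "A \<inter> B \<in> sets borel" "A - B \<in> sets borel" "B - A \<in> sets borel" using A B by auto
  have 1: "E B x = E (A \<inter> B) x + E (B - A) x"
    using E_Un[OF m(1) m(3)] by (metis Diff_disjoint Int_Diff_disjoint Int_Diff_Un Int_commute)
  have 2: "E A y = E (A \<inter> B) y + E (A - B) y" for y
    using E_Un[OF m(1) m(2)] by (metis Int_Diff_disjoint Int_Diff_Un)
  have "E A (E B x) = E A (E (A \<inter> B) x) + E A (E (B - A) x)"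
    by (simp add: 1 E_linear[OF A])
  also have "E A (E (B - A) x) = 0" by (rule E_disjoint) (use A m in auto)
  also have "E A (E (A \<inter> B) x) = E (A \<inter> B) x"
    using E_disjoint[OF m(2) m(1)] by (auto simp: 2[of "E (A \<inter> B) x"] E_idem[OF m(1)])
  finally show ?thesis by simp
qed

section \<open>The finite measures attached to single vectors\<close>

lemma space_scalar [simp]: "space (scalar_measure E x) = UNIV"
  by (simp add: scalar_measure_def space_measure_of_conv)

lemma sets_scalar [simp, measurable_cong]: "sets (scalar_measure E x) = sets borel"
  by (simp add: scalar_measure_def sets_measure_of_conv sets.sigma_sets_eq[of borel, simplified])

text \<open>\<open>measure_of\<close> returns the prescribed values only for a countably additive
  set function. Here additivity is the strong convergence of the projections, passed through the
  inner product with \<open>x\<close>.\<close>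

lemma emeasure_scalar:
  assumes "B \<in> sets borel"
  shows "emeasure (scalar_measure E x) B = ennreal ((norm (E B x))\<^sup>2)"
proof -
  have "emeasure (scalar_measure E x) B = ennreal (Re (cinner (E B x) x))"
  proof (rule emeasure_measure_of[OF scalar_measure_def])
    show "positive (sets (scalar_measure E x)) (\<lambda>B. ennreal (Re (cinner (E B x) x)))"
      by (simp add: positive_def cinner.zero_left)
    show "countably_additive (sets (scalar_measure E x)) (\<lambda>B. ennreal (Re (cinner (E B x) x)))"
      unfolding countably_additive_def
    proof safe
      fix B :: "nat \<Rightarrow> real set"
      assume B: "range B \<subseteq> sets (scalar_measure E x)" "disjoint_family B"
      then have m: "B n \<in> sets borel" for n by auto
      have "(\<lambda>n. cinner (E (B n) x) x) sums cinner (E (\<Union>n. B n) x) x"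
        using B by (intro bounded_linear.sums[OF cinner.bounded_linear_left] E_sums) auto
      then have "(\<lambda>n. Re (cinner (E (B n) x) x)) sums Re (cinner (E (\<Union>n. B n) x) x)"
        by (rule sums_Re)
      then show "(\<Sum>n. ennreal (Re (cinner (E (B n) x) x))) = ennreal (Re (cinner (E (\<Union>n. B n) x) x))"
        by (intro sums_unique[symmetric] sums_ennreal[THEN iffD2])
           (use E_quad[of "\<Union>n. B n" x] m in \<open>auto simp: E_quad sets.countable_UN\<close>)
    qed
  qed (use assms in auto)
  then show ?thesis by (simp add: E_quad assms)
qed

lemma measure_scalar: "B \<in> sets borel \<Longrightarrow> measure (scalar_measure E x) B = (norm (E B x))\<^sup>2"
  by (simp add: measure_def emeasure_scalar)

lemma finite_scalar: "finite_measure (scalar_measure E x)"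
  by (rule finite_measureI) (simp add: emeasure_scalar)

lemma integrable_scalar:
  assumes "g \<in> borel_measurable borel" "\<And>s. \<bar>g s\<bar> \<le> (M::real)"
  shows "integrable (scalar_measure E x) g"
  by (rule finite_measure.integrable_const_bound[OF finite_scalar, of _ M])
     (use assms in \<open>auto simp: measurable_cong_sets[OF sets_scalar refl]\<close>)

end

section \<open>Bounded functional calculus\<close>

context pvm
begin

text \<open>A relation and not a function of \<open>g\<close>: the same \<open>g\<close> has many
  representations by possibly overlapping indicators. The operator is carried along with the
  representation, and independence of it follows later from \<open>limit_op_unique\<close>.\<close>

inductive simple_op :: "(real \<Rightarrow> real) \<Rightarrow> ('h \<Rightarrow> 'h) \<Rightarrow> bool" where
  zero: "simple_op (\<lambda>s. 0) (\<lambda>x. 0)"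
| add: "simple_op g T \<Longrightarrow> B \<in> sets borel \<Longrightarrow>
    simple_op (\<lambda>s. g s + c * indicator B s) (\<lambda>x. T x + c *\<^sub>R E B x)"

lemma simple_op_measurable: "simple_op g T \<Longrightarrow> g \<in> borel_measurable borel"
  by (induction rule: simple_op.induct) auto

lemma simple_op_bounded: "simple_op g T \<Longrightarrow> \<exists>M. \<forall>s. \<bar>g s\<bar> \<le> M"
proof (induction rule: simple_op.induct)
  case (add g T B c)
  then obtain M where M: "\<bar>g s\<bar> \<le> M" for s by auto
  have "\<bar>g s + c * indicator B s\<bar> \<le> M + \<bar>c\<bar>" for s
    using M[of s] by (auto simp: indicator_def)
  then show ?case by blast
qed auto

lemma simple_op_linear:
  "simple_op g T \<Longrightarrow> T (x + y) = T x + T y \<and> T (c *\<^sub>C x) = c *\<^sub>C T x"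
  by (induction rule: simple_op.induct)
     (auto simp: E_linear scaleC_add_right scaleR_add_right scaleC_scaleR)

lemma simple_op_sym: "simple_op g T \<Longrightarrow> cinner (T x) y = cinner x (T y)"
  by (induction rule: simple_op.induct)
     (auto simp: cinner.zero_left cinner.zero_right cinner_add_left cinner_add_right
       cinner_scaleR_left cinner_scaleR_right E_sym)

text \<open>The bridge from operators to integrals: norm bounds, limits and uniqueness are read off
  the quadratic form.\<close>

lemma simple_op_quad:
  "simple_op g T \<Longrightarrow> cinner (T x) x = complex_of_real (\<integral>s. g s \<partial>scalar_measure E x)"
proof (induction rule: simple_op.induct)
  case (add g T B c)
  obtain M where "\<bar>g s\<bar> \<le> M" for s using simple_op_bounded[OF add(1)] by auto
  then have i: "integrable (scalar_measure E x) g"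
    using integrable_scalar simple_op_measurable[OF add(1)] by blast
  have "integrable (scalar_measure E x) (\<lambda>s. c * indicator B s)"
    by (rule integrable_scalar[of _ "\<bar>c\<bar>"]) (use add in \<open>auto simp: indicator_def\<close>)
  then show ?case
    using add i
    by (simp add: cinner_add_left cinner_scaleR_left E_quad measure_scalar)
qed (simp add: cinner.zero_left)

lemma simple_op_plus:
  assumes "simple_op g T"
  shows "simple_op k U \<Longrightarrow> simple_op (\<lambda>s. g s + k s) (\<lambda>x. T x + U x)"
proof (induction rule: simple_op.induct)
  case (add k U B c)
  then show ?case using simple_op.add[OF add(3,2), of c] by (simp add: add.assoc)
qed (use assms in simp)

lemma simple_op_scale: "simple_op g T \<Longrightarrow> simple_op (\<lambda>s. c * g s) (\<lambda>x. c *\<^sub>R T x)"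
proof (induction rule: simple_op.induct)
  case (add k U B d)
  then show ?case using simple_op.add[OF add(3,2), of "c * d"]
    by (simp add: algebra_simps)
qed (simp add: simple_op.zero)

lemma simple_op_indicator: "B \<in> sets borel \<Longrightarrow> simple_op (indicator B) (E B)"
  using simple_op.add[OF simple_op.zero, of B 1] by simp

lemma simple_op_indicator_times:
  assumes "C \<in> sets borel"
  shows "simple_op k U \<Longrightarrow> simple_op (\<lambda>s. indicator C s * k s) (\<lambda>x. E C (U x))"
proof (induction rule: simple_op.induct)
  case (add k U B c)
  then show ?case using simple_op.add[OF add(3), of "C \<inter> B" c] assms
    by (simp add: algebra_simps E_linear E_Int indicator_inter_arith)
qed (use assms in \<open>simp add: E_linear simple_op.zero\<close>)

lemma simple_op_times:
  assumes "simple_op k U"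
  shows "simple_op g T \<Longrightarrow> simple_op (\<lambda>s. g s * k s) (\<lambda>x. T (U x))"
proof (induction rule: simple_op.induct)
  case (add g T B c)
  show ?case
    using simple_op_plus[OF add(3) simple_op_scale[OF simple_op_indicator_times[OF add(2) assms]], of c]
    by (simp add: algebra_simps)
qed (use simple_op.zero in simp)

lemma simple_op_sum:
  "finite I \<Longrightarrow> (\<And>i. i \<in> I \<Longrightarrow> B i \<in> sets borel) \<Longrightarrow>
    \<exists>T. simple_op (\<lambda>s. \<Sum>i\<in>I. c i * indicator (B i) s) T"
proof (induction rule: finite_induct)
  case (insert i I)
  then obtain T where T: "simple_op (\<lambda>s. \<Sum>i\<in>I. c i * indicator (B i) s) T" by auto
  from simple_op.add[OF T, of "B i" "c i"] insert
  have "\<exists>T. simple_op (\<lambda>s. (\<Sum>j\<in>I. c j * indicator (B j) s) + c i * indicator (B i) s) T" by blast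
  with insert.hyps show ?case by (simp only: sum.insert add.commute if_False simp_thms) 
qed (auto intro: simple_op.zero)

text \<open>Symmetry and multiplicativity turn the squared norm of \<open>T x\<close> into the
  integral of \<open>g s * g s\<close>, and the whole line has measure
  \<open>(norm x)\<^sup>2\<close>.\<close>

lemma simple_op_norm_le:
  assumes "simple_op g T" "\<And>s. \<bar>g s\<bar> \<le> M"
  shows "norm (T x) \<le> M * norm x"
proof -
  have M: "0 \<le> M" using assms(2)[of 0] by linarith
  have "simple_op (\<lambda>s. g s * g s) (\<lambda>x. T (T x))" by (rule simple_op_times) (fact assms)+
  from simple_op_quad[OF this, of x]
  have "complex_of_real ((norm (T x))\<^sup>2) = complex_of_real (\<integral>s. g s * g s \<partial>scalar_measure E x)"
    using cinner_self[of "T x"] simple_op_sym[OF assms(1), of "T x" x] by metis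
  then have "(norm (T x))\<^sup>2 = (\<integral>s. g s * g s \<partial>scalar_measure E x)"
    using of_real_eq_iff by blast
  also have "\<dots> \<le> (\<integral>s. M\<^sup>2 \<partial>scalar_measure E x)"
  proof (rule integral_mono)
    have *: "\<bar>g s * g s\<bar> \<le> M\<^sup>2" for s
      using mult_mono[OF assms(2)[of s] assms(2)[of s]] M by (simp add: abs_mult power2_eq_square)
    then show "integrable (scalar_measure E x) (\<lambda>s. g s * g s)"
      using simple_op_measurable[OF assms(1)] by (intro integrable_scalar) auto
    show "g s * g s \<le> M\<^sup>2" for s using *[of s] by linarith
  qed (rule finite_measure.integrable_const[OF finite_scalar])
  also have "\<dots> = (M * norm x)\<^sup>2"
    using measure_scalar[of UNIV x] by (simp add: power_mult_distrib)
  finally show ?thesis by (rule power2_le_imp_le) (use M in simp)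
qed

section \<open>Bounded Borel functions and uniform limits of simple operators\<close>

definition bounded_borel :: "(real \<Rightarrow> real) \<Rightarrow> bool" where
  "bounded_borel g \<longleftrightarrow> g \<in> borel_measurable borel \<and> (\<exists>M. \<forall>s. \<bar>g s\<bar> \<le> M)"

lemma bounded_borel_add:
  assumes "bounded_borel g" "bounded_borel k"
  shows "bounded_borel (\<lambda>s. g s + k s)"
proof -
  obtain M N where M: "\<And>s. \<bar>g s\<bar> \<le> M" and N: "\<And>s. \<bar>k s\<bar> \<le> N"
    using assms by (auto simp: bounded_borel_def)
  have "\<bar>g s + k s\<bar> \<le> M + N" for s using M[of s] N[of s] by linarith
  with assms show ?thesis by (auto simp: bounded_borel_def)
qed

lemma bounded_borel_mult:
  assumes "bounded_borel g" "bounded_borel k"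
  shows "bounded_borel (\<lambda>s. g s * k s)"
proof -
  obtain M N where M: "\<And>s. \<bar>g s\<bar> \<le> M" and N: "\<And>s. \<bar>k s\<bar> \<le> N"
    using assms by (auto simp: bounded_borel_def)
  have "\<bar>g s * k s\<bar> \<le> M * N" for s
    using mult_mono[OF M[of s] N[of s]] M[of s] by (simp add: abs_mult)
  with assms show ?thesis by (auto simp: bounded_borel_def)
qed

lemma bounded_borel_const: "bounded_borel (\<lambda>s. c)"
  by (auto simp: bounded_borel_def)

lemma bounded_borel_scale: "bounded_borel g \<Longrightarrow> bounded_borel (\<lambda>s. c * g s)"
  by (rule bounded_borel_mult[OF bounded_borel_const])

lemma bounded_borel_diff: "bounded_borel g \<Longrightarrow> bounded_borel k \<Longrightarrow> bounded_borel (\<lambda>s. g s - k s)"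
  using bounded_borel_add[of g "\<lambda>s. -1 * k s"] bounded_borel_scale[of k "-1"] by simp

lemma bounded_borel_indicator: "B \<in> sets borel \<Longrightarrow> bounded_borel (indicator B)"
  unfolding bounded_borel_def
  by (intro conjI borel_measurable_indicator exI[of _ 1] allI indicator_abs_le_1)

lemma bounded_borel_integrable: "bounded_borel g \<Longrightarrow> integrable (scalar_measure E x) g"
  unfolding bounded_borel_def by (elim conjE exE) (rule integrable_scalar, assumption, erule spec)

text \<open>Again a relation, since the approximating sequence is a choice. Uniform convergence of
  the functions controls the operator norms, so strong convergence of the operators survives
  products.\<close>

definition limit_op :: "(real \<Rightarrow> real) \<Rightarrow> ('h \<Rightarrow> 'h) \<Rightarrow> bool" where
  "limit_op g T \<longleftrightarrow> (\<exists>gn Tn. (\<forall>n. simple_op (gn n) (Tn n)) \<and>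
     uniform_limit UNIV gn g sequentially \<and> (\<forall>x. (\<lambda>n. Tn n x) \<longlonglongrightarrow> T x))"

lemma limit_opE:
  assumes "limit_op g T"
  obtains gn Tn where "\<And>n. simple_op (gn n) (Tn n)" "uniform_limit UNIV gn g sequentially"
    "\<And>x. (\<lambda>n. Tn n x) \<longlonglongrightarrow> T x"
  using assms unfolding limit_op_def by blast

lemma limit_op_linear:
  assumes "limit_op g T"
  shows "T (x + y) = T x + T y" "T (c *\<^sub>C x) = c *\<^sub>C T x"
proof -
  obtain gn Tn where s: "\<And>n. simple_op (gn n) (Tn n)" and l: "\<And>x. (\<lambda>n. Tn n x) \<longlonglongrightarrow> T x"
    using assms by (elim limit_opE) blast
  show "T (x + y) = T x + T y"
    using LIMSEQ_unique[OF l[of "x + y"]] tendsto_add[OF l[of x] l[of y]]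
    by (simp add: simple_op_linear[OF s])
  show "T (c *\<^sub>C x) = c *\<^sub>C T x"
    using LIMSEQ_unique[OF l[of "c *\<^sub>C x"]] scaleC.tendsto[OF tendsto_const[of c] l[of x]]
    by (simp add: simple_op_linear[OF s])
qed

lemma limit_op_sym:
  assumes "limit_op g T"
  shows "cinner (T x) y = cinner x (T y)"
proof -
  obtain gn Tn where s: "\<And>n. simple_op (gn n) (Tn n)" and l: "\<And>x. (\<lambda>n. Tn n x) \<longlonglongrightarrow> T x"
    using assms by (elim limit_opE) blast
  show ?thesis
    using LIMSEQ_unique[OF cinner.tendsto[OF l[of x] tendsto_const[of y]]]
      cinner.tendsto[OF tendsto_const[of x] l[of y]]
    by (simp add: simple_op_sym[OF s])
qed

lemma limit_op_quad:
  assumes "limit_op g T" "bounded_borel g"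
  shows "cinner (T x) x = complex_of_real (\<integral>s. g s \<partial>scalar_measure E x)"
proof -
  let ?M = "scalar_measure E x"
  obtain gn Tn where s: "\<And>n. simple_op (gn n) (Tn n)" and u: "uniform_limit UNIV gn g sequentially"
    and l: "\<And>x. (\<lambda>n. Tn n x) \<longlonglongrightarrow> T x"
    using assms by (elim limit_opE) blast
  interpret finite_measure ?M by (rule finite_scalar)
  have bb: "bounded_borel (gn n)" for n
    using simple_op_bounded[OF s] simple_op_measurable[OF s] by (auto simp: bounded_borel_def)
  have "(\<lambda>n. \<integral>s. gn n s \<partial>?M) \<longlonglongrightarrow> (\<integral>s. g s \<partial>?M)"
  proof (rule tendstoI)
    fix e :: real assume e: "0 < e"
    \<comment> \<open>The summand 1 keeps the denominator positive when the measure is zero, as it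
      is for \<open>x = 0\<close>.\<close>
    define d where "d = e / (measure ?M UNIV + 1)"
    have d: "d > 0" using e by (simp add: d_def add_nonneg_pos)
    from uniform_limitD[OF u d]
    show "\<forall>\<^sub>F n in sequentially. dist (\<integral>s. gn n s \<partial>?M) (\<integral>s. g s \<partial>?M) < e"
    proof eventually_elim
      case (elim n)
      have "dist (\<integral>s. gn n s \<partial>?M) (\<integral>s. g s \<partial>?M) = \<bar>\<integral>s. gn n s - g s \<partial>?M\<bar>"
        by (simp add: dist_real_def Bochner_Integration.integral_diff bounded_borel_integrable bb assms)
      also have "\<dots> \<le> (\<integral>s. \<bar>gn n s - g s\<bar> \<partial>?M)"
        by (rule integral_abs_bound)
      also have "\<dots> \<le> (\<integral>s. d \<partial>?M)"
        using elim by (intro integral_mono integrable_abs bounded_borel_integrable bounded_borel_diff bb assms)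
           (auto simp: dist_real_def less_imp_le bounded_borel_const)
      also have "\<dots> = d * measure ?M UNIV" by simp
      also have "\<dots> < d * (measure ?M UNIV + 1)" using d by simp
      also have "\<dots> = e" unfolding d_def
        using measure_nonneg[of ?M UNIV] by (simp add: add_nonneg_eq_0_iff)
      finally show ?case .
    qed
  qed
  then have "(\<lambda>n. complex_of_real (\<integral>s. gn n s \<partial>?M)) \<longlonglongrightarrow> complex_of_real (\<integral>s. g s \<partial>?M)"
    by (rule tendsto_of_real)
  moreover have "(\<lambda>n. cinner (Tn n x) x) \<longlonglongrightarrow> cinner (T x) x"
    by (rule cinner.tendsto[OF l tendsto_const])
  ultimately show ?thesis
    using LIMSEQ_unique by (simp add: simple_op_quad[OF s])
qed

lemma simple_limit_op: "simple_op g T \<Longrightarrow> limit_op g T"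
  unfolding limit_op_def by (intro exI[of _ "\<lambda>_. g"] exI[of _ "\<lambda>_. T"]) (auto intro: uniform_limit_const)

lemma limit_op_plus:
  assumes "limit_op g T" "limit_op k U"
  shows "limit_op (\<lambda>s. g s + k s) (\<lambda>x. T x + U x)"
proof -
  obtain gn Tn where "\<And>n. simple_op (gn n) (Tn n)" "uniform_limit UNIV gn g sequentially"
    "\<And>x. (\<lambda>n. Tn n x) \<longlonglongrightarrow> T x"
    using assms(1) by (elim limit_opE) blast
  moreover obtain kn Wn where "\<And>n. simple_op (kn n) (Wn n)" "uniform_limit UNIV kn k sequentially"
    "\<And>x. (\<lambda>n. Wn n x) \<longlonglongrightarrow> U x"
    using assms(2) by (elim limit_opE) blast
  ultimately show ?thesis
    unfolding limit_op_def
    by (intro exI[of _ "\<lambda>n s. gn n s + kn n s"] exI[of _ "\<lambda>n x. Tn n x + Wn n x"])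
       (auto intro!: simple_op_plus uniform_limit_intros tendsto_intros)
qed

lemma limit_op_times:
  assumes "limit_op g T" "limit_op k U" "bounded_borel g" "bounded_borel k"
  shows "limit_op (\<lambda>s. g s * k s) (\<lambda>x. T (U x))"
proof -
  obtain gn Tn where t: "\<And>n. simple_op (gn n) (Tn n)" "uniform_limit UNIV gn g sequentially"
    "\<And>x. (\<lambda>n. Tn n x) \<longlonglongrightarrow> T x"
    using assms(1) by (elim limit_opE) blast
  obtain kn Wn where u: "\<And>n. simple_op (kn n) (Wn n)" "uniform_limit UNIV kn k sequentially"
    "\<And>x. (\<lambda>n. Wn n x) \<longlonglongrightarrow> U x"
    using assms(2) by (elim limit_opE) blast
  obtain M where M: "\<And>s. \<bar>g s\<bar> \<le> M" using assms(3) by (auto simp: bounded_borel_def)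
  \<comment> \<open>A common bound on the functions makes the operators \<open>Tn n\<close>
    eventually uniformly bounded, which carries strong convergence through the composition.\<close>
  have ev: "\<forall>\<^sub>F n in sequentially. \<forall>s. \<bar>gn n s\<bar> \<le> M + 1"
    using uniform_limitD[OF t(2) zero_less_one]
  proof eventually_elim
    case (elim n)
    show ?case
    proof
      fix s show "\<bar>gn n s\<bar> \<le> M + 1" using elim[simplified] M[of s]
        by (simp add: dist_real_def) (smt (verit))
    qed
  qed
  have "(\<lambda>n. Tn n (Wn n x)) \<longlonglongrightarrow> T (U x)" for x
  proof -
    have "(\<lambda>n. Tn n (Wn n x - U x)) \<longlonglongrightarrow> 0"
    proof (rule Lim_null_comparison)
      show "\<forall>\<^sub>F n in sequentially. norm (Tn n (Wn n x - U x)) \<le> (M + 1) * norm (Wn n x - U x)"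
        using ev by eventually_elim (rule simple_op_norm_le[OF t(1)], auto)
      show "(\<lambda>n. (M + 1) * norm (Wn n x - U x)) \<longlonglongrightarrow> 0"
        using u(3)[of x] by (auto intro!: tendsto_mult_right_zero tendsto_norm_zero simp: LIM_zero)
    qed
    from tendsto_add[OF this t(3)[of "U x"]]
    have "(\<lambda>n. Tn n (Wn n x - U x) + Tn n (U x)) \<longlonglongrightarrow> T (U x)" by simp
    then show ?thesis
      by (simp add: simple_op_linear[OF t(1), THEN conjunct1, symmetric])
  qed
  moreover have "uniform_limit UNIV (\<lambda>n s. gn n s * kn n s) (\<lambda>s. g s * k s) sequentially"
    using assms(3,4) t(2) u(2)
    by (intro uniform_lim_mult) (auto simp: bounded_borel_def bounded_iff)
  ultimately show ?thesis
    unfolding limit_op_def using simple_op_times[OF u(1) t(1)]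
    by (intro exI[of _ "\<lambda>n s. gn n s * kn n s"] exI[of _ "\<lambda>n x. Tn n (Wn n x)"])
       simp
qed

end

text \<open>Written in the shape of \<open>spectral_form\<close>, so that knowledge of quadratic
  forms becomes knowledge of operators.\<close>

lemma cinner_polarization:
  fixes T :: "'a::complex_inner \<Rightarrow> 'a"
  assumes "\<And>x y. T (x + y) = T x + T y" "\<And>c x. T (c *\<^sub>C x) = c *\<^sub>C T x"
  shows "cinner (T x) z = (\<Sum>k<4. \<i> ^ k * cinner (T (x + \<i> ^ k *\<^sub>C z)) (x + \<i> ^ k *\<^sub>C z)) / 4"
proof -
  have "\<i> ^ 2 = -1" "\<i> ^ 3 = -\<i>" by (simp_all add: power3_eq_cube)
  then show ?thesis
    by (simp add: eval_nat_numeral assms cinner_add_left cinner_add_right cinner_scaleC_left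
        cinner_scaleC_right algebra_simps)
qed

context pvm
begin

lemma bounded_borel_power2: "bounded_borel g \<Longrightarrow> bounded_borel (\<lambda>s. (g s)\<^sup>2)"
  by (simp add: power2_eq_square bounded_borel_mult)

lemma limit_op_exists:
  assumes "bounded_borel g"
  shows "\<exists>T. limit_op g T"
proof -
  \<comment> \<open>\<open>g\<close> is rounded down to multiples of \<open>1 / (n + 1)\<close>: the
    error is uniform in \<open>s\<close>, and boundedness of \<open>g\<close> leaves finitely many
    values.\<close>
  define gn where "gn n s = real_of_int \<lfloor>real (Suc n) * g s\<rfloor> / real (Suc n)" for n s
  have [measurable]: "g \<in> borel_measurable borel" using assms by (simp add: bounded_borel_def)
  obtain M where M: "\<And>s. \<bar>g s\<bar> \<le> M" using assms by (auto simp: bounded_borel_def)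
  have close: "\<bar>gn n s - g s\<bar> \<le> 1 / real (Suc n)" for n s
  proof -
    have "\<bar>real_of_int \<lfloor>real (Suc n) * g s\<rfloor> - real (Suc n) * g s\<bar> \<le> 1" by linarith
    then have "\<bar>(gn n s - g s) * real (Suc n)\<bar> \<le> 1"
      by (simp add: gn_def algebra_simps del: of_nat_Suc)
    then have "\<bar>gn n s - g s\<bar> * real (Suc n) \<le> 1" by (simp only: abs_mult abs_of_nat)
    then show ?thesis by (simp add: pos_le_divide_eq del: of_nat_Suc)
  qed
  have "\<exists>T. simple_op (gn n) T" for n
  proof -
    define K where "K = \<lceil>real (Suc n) * M\<rceil> + 1"
    define B where "B k = {s. \<lfloor>real (Suc n) * g s\<rfloor> = k}" for k
    have bound: "\<lfloor>real (Suc n) * g s\<rfloor> \<in> {-K..K}" for s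
    proof -
      have "real (Suc n) * \<bar>g s\<bar> \<le> real (Suc n) * M" using M[of s] by (intro mult_left_mono) auto
      then have "\<bar>real (Suc n) * g s\<bar> \<le> real (Suc n) * M" by (simp add: abs_mult)
      then show ?thesis unfolding K_def by (simp del: of_nat_Suc) linarith
    qed
    have "gn n s = (\<Sum>k\<in>{-K..K}. real_of_int k / real (Suc n) * indicator (B k) s)" for s
    proof -
      have "(\<Sum>k\<in>{-K..K}. real_of_int k / real (Suc n) * indicator (B k) s)
        = (\<Sum>k\<in>{-K..K}. if k = \<lfloor>real (Suc n) * g s\<rfloor> then gn n s else 0)"
        by (intro sum.cong) (auto simp: B_def gn_def indicator_def)
      also have "\<dots> = gn n s" using bound[of s] by (simp del: of_nat_Suc atLeastAtMost_iff)
      finally show ?thesis by simp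
    qed
    then have "gn n = (\<lambda>s. \<Sum>k\<in>{-K..K}. real_of_int k / real (Suc n) * indicator (B k) s)"
      by (rule ext)
    moreover have "B k \<in> sets borel" for k unfolding B_def by measurable
    ultimately show ?thesis
      using simple_op_sum[of "{-K..K}" B "\<lambda>k. real_of_int k / real (Suc n)"] by simp
  qed
  then obtain Tn where Tn: "\<And>n. simple_op (gn n) (Tn n)" by metis
  \<comment> \<open>The difference of two approximants belongs to a function of size at most
    \<open>1 / (m + 1) + 1 / (n + 1)\<close>, so the operators form a Cauchy sequence.\<close>
  have close2: "norm (Tn m x - Tn n x) \<le> (1 / real (Suc m) + 1 / real (Suc n)) * norm x" for m n x
  proof -
    have "simple_op (\<lambda>s. gn m s + -1 * gn n s) (\<lambda>x. Tn m x + -1 *\<^sub>R Tn n x)"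
      by (intro simple_op_plus simple_op_scale Tn)
    moreover have "\<bar>gn m s + -1 * gn n s\<bar> \<le> 1 / real (Suc m) + 1 / real (Suc n)" for s
      using close[of m s] close[of n s] by linarith
    ultimately have "norm (Tn m x + -1 *\<^sub>R Tn n x) \<le> (1 / real (Suc m) + 1 / real (Suc n)) * norm x"
      by (rule simple_op_norm_le)
    then show ?thesis by simp
  qed
  have inv0: "(\<lambda>n. 1 / real (Suc n)) \<longlonglongrightarrow> 0" using LIMSEQ_inverse_real_of_nat by (simp add: field_simps)
  have "convergent (\<lambda>n. Tn n x)" for x
  proof (rule Cauchy_convergent, rule metric_CauchyI)
    fix e :: real assume "0 < e"
    have "(\<lambda>n. 1 / real (Suc n) * norm x) \<longlonglongrightarrow> 0"
      using tendsto_mult_left_zero[OF inv0] by simp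
    from order_tendstoD(2)[OF this, of "e / 2"] \<open>0 < e\<close>
    obtain N where N: "\<And>n. n \<ge> N \<Longrightarrow> 1 / real (Suc n) * norm x < e / 2"
      by (auto simp: eventually_sequentially)
    show "\<exists>M. \<forall>m\<ge>M. \<forall>n\<ge>M. dist (Tn m x) (Tn n x) < e"
    proof (intro exI allI impI)
      fix m n assume "m \<ge> N" "n \<ge> N"
      then show "dist (Tn m x) (Tn n x) < e"
        using N[of m] N[of n] close2[of m x n] unfolding dist_norm distrib_right by linarith
    qed
  qed
  then have lim: "(\<lambda>n. Tn n x) \<longlonglongrightarrow> lim (\<lambda>n. Tn n x)" for x
    by (simp add: convergent_LIMSEQ_iff)
  have "uniform_limit UNIV gn g sequentially"
  proof (rule uniform_limitI)
    fix e :: real assume "0 < e"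
    from order_tendstoD(2)[OF inv0 this]
    show "\<forall>\<^sub>F n in sequentially. \<forall>s\<in>UNIV. dist (gn n s) (g s) < e"
      by eventually_elim (use close in \<open>auto simp: dist_real_def simp del: of_nat_Suc intro: le_less_trans\<close>)
  qed
  then show ?thesis unfolding limit_op_def using Tn lim
    by (intro exI[of _ "\<lambda>x. lim (\<lambda>n. Tn n x)"] exI[of _ gn] exI[of _ Tn]) auto
qed

section \<open>The calculus for bounded Borel functions\<close>

definition Phi :: "(real \<Rightarrow> real) \<Rightarrow> 'h \<Rightarrow> 'h" where
  "Phi g = (SOME T. limit_op g T)"

lemma limit_op_Phi: "bounded_borel g \<Longrightarrow> limit_op g (Phi g)"
  unfolding Phi_def by (rule someI_ex[OF limit_op_exists])

lemma Phi_linear: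
  assumes "bounded_borel g"
  shows "Phi g (x + y) = Phi g x + Phi g y" "Phi g (c *\<^sub>C x) = c *\<^sub>C Phi g x"
    "Phi g (r *\<^sub>R x) = r *\<^sub>R Phi g x" "Phi g (x - y) = Phi g x - Phi g y" "Phi g 0 = 0"
    "Phi g (- x) = - Phi g x"
proof -
  show 1: "Phi g (x + y) = Phi g x + Phi g y" and 2: "Phi g (c *\<^sub>C x) = c *\<^sub>C Phi g x" for x y c
    using limit_op_linear[OF limit_op_Phi[OF assms]] by auto
  show "Phi g (r *\<^sub>R x) = r *\<^sub>R Phi g x" by (metis 2 scaleC_of_real)
  show 3: "Phi g (- x) = - Phi g x" for x by (metis 2 scaleC_minus1)
  show "Phi g (x - y) = Phi g x - Phi g y" using 1[of x "-y"] 3[of y] by simp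
  show "Phi g 0 = 0" using 1[of 0 0] by simp
qed

lemma Phi_sym: "bounded_borel g \<Longrightarrow> cinner (Phi g x) y = cinner x (Phi g y)"
  by (rule limit_op_sym[OF limit_op_Phi])

lemma Phi_quad:
  "bounded_borel g \<Longrightarrow> cinner (Phi g x) x = complex_of_real (\<integral>s. g s \<partial>scalar_measure E x)"
  by (rule limit_op_quad[OF limit_op_Phi])

lemma limit_op_form:
  assumes "limit_op g T" "bounded_borel g"
  shows "cinner (T x) z = spectral_form E UNIV g x z"
proof -
  have "cinner (T x) z = (\<Sum>k<4. \<i> ^ k * cinner (T (x + \<i> ^ k *\<^sub>C z)) (x + \<i> ^ k *\<^sub>C z)) / 4"
    by (rule cinner_polarization) (rule limit_op_linear[OF assms(1)])+
  then show ?thesis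
    by (simp add: spectral_form_def limit_op_quad[OF assms] set_lebesgue_integral_def)
qed

text \<open>By polarization the integrals of \<open>g\<close> determine every
  \<open>\<langle>T x, z\<rangle>\<close>. Hence the choice made in \<open>Phi\<close> is harmless,
  and sums, products and indicators are computed by exhibiting any limit operator for the combined
  function.\<close>

lemma limit_op_unique:
  assumes "limit_op g T" "bounded_borel g"
  shows "T = Phi g"
proof
  show "T x = Phi g x" for x
    by (rule cinner_eq_iff) (simp only: limit_op_form[OF assms] limit_op_form[OF limit_op_Phi[OF assms(2)] assms(2)])
qed

lemma Phi_add: "bounded_borel g \<Longrightarrow> bounded_borel k \<Longrightarrow> Phi (\<lambda>s. g s + k s) x = Phi g x + Phi k x"
  by (rule fun_cong[OF limit_op_unique[OF limit_op_plus[OF limit_op_Phi limit_op_Phi]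
        bounded_borel_add], symmetric])

lemma Phi_mult: "bounded_borel g \<Longrightarrow> bounded_borel k \<Longrightarrow> Phi (\<lambda>s. g s * k s) x = Phi g (Phi k x)"
  by (rule fun_cong[OF limit_op_unique[OF limit_op_times[OF limit_op_Phi limit_op_Phi]
        bounded_borel_mult], symmetric])

lemma Phi_indicator: "B \<in> sets borel \<Longrightarrow> Phi (indicator B) x = E B x"
  by (rule fun_cong[OF limit_op_unique[OF simple_limit_op[OF simple_op_indicator]
        bounded_borel_indicator], symmetric])

lemma Phi_const: "Phi (\<lambda>s. c) x = c *\<^sub>R x"
proof -
  have "simple_op (\<lambda>s. c * indicator UNIV s) (\<lambda>x. c *\<^sub>R E UNIV x)"
    by (intro simple_op_scale simple_op_indicator) simp
  then show ?thesis
    using fun_cong[OF limit_op_unique[OF simple_limit_op bounded_borel_const[of c]]] by simp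
qed

lemma Phi_scale: "bounded_borel g \<Longrightarrow> Phi (\<lambda>s. c * g s) x = c *\<^sub>R Phi g x"
  by (simp add: Phi_mult bounded_borel_const Phi_const)

lemma Phi_diff: "bounded_borel g \<Longrightarrow> bounded_borel k \<Longrightarrow> Phi (\<lambda>s. g s - k s) x = Phi g x - Phi k x"
  using Phi_add[of g "\<lambda>s. -1 * k s"] Phi_scale[of k "-1"] bounded_borel_scale[of k "-1"] by simp

lemma Phi_norm_square:
  assumes "bounded_borel g"
  shows "(norm (Phi g x))\<^sup>2 = (\<integral>s. (g s)\<^sup>2 \<partial>scalar_measure E x)"
proof -
  have "complex_of_real ((norm (Phi g x))\<^sup>2) = cinner (Phi g (Phi g x)) x"
    by (simp only: Phi_sym[OF assms] cinner_self)
  also have "\<dots> = complex_of_real (\<integral>s. g s * g s \<partial>scalar_measure E x)"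
    by (simp only: Phi_mult[OF assms assms, symmetric] Phi_quad[OF bounded_borel_mult[OF assms assms]])
  finally have "(norm (Phi g x))\<^sup>2 = (\<integral>s. g s * g s \<partial>scalar_measure E x)"
    using of_real_eq_iff by blast
  then show ?thesis by (simp add: power2_eq_square)
qed

lemma Phi_norm_mono:
  assumes "bounded_borel g" "bounded_borel k" "\<And>s. \<bar>g s\<bar> \<le> \<bar>k s\<bar>"
  shows "norm (Phi g x) \<le> norm (Phi k x)"
proof (rule power2_le_imp_le)
  show "(norm (Phi g x))\<^sup>2 \<le> (norm (Phi k x))\<^sup>2"
    unfolding Phi_norm_square[OF assms(1)] Phi_norm_square[OF assms(2)]
    by (intro integral_mono bounded_borel_integrable bounded_borel_power2 assms(1,2))
       (simp add: assms(3) flip: abs_le_square_iff)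
qed simp

lemma Phi_norm_le:
  assumes "bounded_borel g" "\<And>s. \<bar>g s\<bar> \<le> M"
  shows "norm (Phi g x) \<le> M * norm x"
  using Phi_norm_mono[OF assms(1) bounded_borel_const[of M]] assms(2)
  by (simp add: Phi_const) (metis abs_ge_zero abs_of_nonneg order_trans)

lemma Phi_quad_nonneg:
  "bounded_borel g \<Longrightarrow> (\<And>s. 0 \<le> g s) \<Longrightarrow> 0 \<le> Re (cinner (Phi g x) x)"
  by (simp add: Phi_quad)

lemma Phi_bounded_linear: "bounded_borel g \<Longrightarrow> bounded_linear (Phi g)"
proof -
  assume g: "bounded_borel g"
  then obtain M where "\<And>s. \<bar>g s\<bar> \<le> M" by (auto simp: bounded_borel_def)
  then show ?thesis
    by (intro bounded_linear_intro[of _ M]) (auto simp: Phi_linear g mult.commute Phi_norm_le)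
qed

end

section \<open>Unbounded spectral integrals\<close>

text \<open>Moves the set into the integrand, so that integrals over the spectrum fall under the
  theory for the whole line.\<close>

lemma spectral_integral_indicator:
  "spectral_integral E S g = spectral_integral E UNIV (\<lambda>s. indicator S s * g s)"
proof -
  have "ennreal ((g s)\<^sup>2) * indicator S s = ennreal ((indicator S s * g s)\<^sup>2)" for s
    by (simp add: indicator_def)
  then have "spectral_domain E S g = spectral_domain E UNIV (\<lambda>s. indicator S s * g s)"
    by (simp add: spectral_domain_def)
  moreover have "spectral_form E S g = spectral_form E UNIV (\<lambda>s. indicator S s * g s)"
    by (intro ext) (simp add: spectral_form_def set_lebesgue_integral_def)
  ultimately show ?thesis unfolding spectral_integral_def by presburger
qed

context pvm
begin

section \<open>Truncation to bounded windows\<close>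

abbreviation cut :: "nat \<Rightarrow> real \<Rightarrow> real" where
  "cut n \<equiv> indicator {- real n..real n}"

definition P :: "nat \<Rightarrow> 'h \<Rightarrow> 'h" where
  "P n = Phi (cut n)"

definition locally_bounded :: "(real \<Rightarrow> real) \<Rightarrow> bool" where
  "locally_bounded g \<longleftrightarrow> g \<in> borel_measurable borel \<and> (\<forall>n. bounded_borel (\<lambda>s. cut n s * g s))"

text \<open>The part of the spectral integral of \<open>g\<close> that lives on the window
  \<open>{- real n..real n}\<close>; for locally bounded \<open>g\<close> it is bounded and defined
  everywhere, even where the integral itself is not.\<close>

definition Op :: "nat \<Rightarrow> (real \<Rightarrow> real) \<Rightarrow> 'h \<Rightarrow> 'h" where
  "Op n g = Phi (\<lambda>s. cut n s * g s)"

lemma bounded_borel_cut [simp]: "bounded_borel (cut n)"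
  by (rule bounded_borel_indicator) simp

lemma bounded_locally_bounded: "bounded_borel g \<Longrightarrow> locally_bounded g"
  by (simp add: locally_bounded_def bounded_borel_mult) (simp add: bounded_borel_def)

lemma locally_boundedI:
  assumes "g \<in> borel_measurable borel" "\<And>n. \<exists>M. \<forall>s. \<bar>s\<bar> \<le> real n \<longrightarrow> \<bar>g s\<bar> \<le> M"
  shows "locally_bounded g"
  unfolding locally_bounded_def bounded_borel_def
proof (intro conjI allI assms(1))
  fix n
  show "(\<lambda>s. cut n s * g s) \<in> borel_measurable borel" using assms(1) by measurable
  obtain M where "\<forall>s. \<bar>s\<bar> \<le> real n \<longrightarrow> \<bar>g s\<bar> \<le> M" using assms(2) by blast
  then have "\<bar>cut n s * g s\<bar> \<le> \<bar>M\<bar>" for s by (fastforce simp: indicator_def abs_le_iff)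
  then show "\<exists>M. \<forall>s. \<bar>cut n s * g s\<bar> \<le> M" by blast
qed

lemma locally_bounded_cut: "locally_bounded g \<Longrightarrow> bounded_borel (\<lambda>s. cut n s * g s)"
  by (simp add: locally_bounded_def)

lemma locally_bounded_times:
  assumes "locally_bounded g" "locally_bounded k"
  shows "locally_bounded (\<lambda>s. g s * k s)"
proof -
  have eq: "cut n s * (g s * k s) = (cut n s * g s) * (cut n s * k s)" for n s
    by (simp add: indicator_def)
  show ?thesis using assms by (auto simp: locally_bounded_def eq intro: bounded_borel_mult)
qed

lemma P_eq_E: "P n x = E {- real n..real n} x"
  by (simp add: P_def Phi_indicator)

lemmas P_linear = Phi_linear[OF bounded_borel_cut, folded P_def]
lemmas P_sym = Phi_sym[OF bounded_borel_cut, folded P_def]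
lemmas Op_linear = Phi_linear[OF locally_bounded_cut, folded Op_def]
lemmas Op_sym = Phi_sym[OF locally_bounded_cut, folded Op_def]

lemma P_norm_le: "norm (P n x) \<le> norm x"
  by (simp add: P_eq_E E_norm_le)

lemma Phi_commute: "bounded_borel g \<Longrightarrow> bounded_borel k \<Longrightarrow> Phi g (Phi k x) = Phi k (Phi g x)"
  by (simp add: Phi_mult[symmetric] mult.commute)

lemma P_Phi: "bounded_borel g \<Longrightarrow> P n (Phi g x) = Phi (\<lambda>s. cut n s * g s) x"
  by (simp add: P_def Phi_mult)

lemma P_Op:
  assumes "locally_bounded g" "m \<le> n"
  shows "P m (Op n g x) = Op m g x"
proof -
  have "(\<lambda>s. cut m s * (cut n s * g s)) = (\<lambda>s. cut m s * g s)"
    using assms(2) by (auto simp: indicator_def)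
  then show ?thesis by (simp only: Op_def P_Phi locally_bounded_cut assms)
qed

lemma P_Op_commute: "locally_bounded g \<Longrightarrow> P m (Op n g x) = P n (Op m g x)"
  by (simp add: Op_def P_Phi locally_bounded_cut mult.left_commute)

lemma P_P: "m \<le> n \<Longrightarrow> P m (P n x) = P m x"
  using P_Op[of "\<lambda>s. 1" m n x] bounded_locally_bounded[OF bounded_borel_const]
  by (simp add: Op_def P_def)

lemma Op_P:
  assumes "locally_bounded g"
  shows "Op n g (P m x) = P m (Op n g x)"
  by (simp add: Op_def P_def Phi_commute locally_bounded_cut assms)

text \<open>The complements of the windows decrease to the empty set, so their finite scalar
  measures, the squared norms of the tails, tend to 0.\<close>

lemma P_tendsto: "(\<lambda>n. P n x) \<longlonglongrightarrow> x"
proof -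
  let ?A = "\<lambda>n. - {- real n..real n}"
  interpret finite_measure "scalar_measure E x" by (rule finite_scalar)
  have "(\<lambda>n. measure (scalar_measure E x) (?A n)) \<longlonglongrightarrow> measure (scalar_measure E x) (\<Inter>n. ?A n)"
    by (rule finite_Lim_measure_decseq) (auto simp: decseq_def)
  moreover have "(\<Inter>n. ?A n) = {}"
  proof -
    have "\<exists>n. \<bar>s\<bar> \<le> real n" for s by (rule real_arch_simple)
    then show ?thesis by (auto simp: abs_le_iff) (metis minus_le_iff)
  qed
  ultimately have "(\<lambda>n. (norm (E (?A n) x))\<^sup>2) \<longlonglongrightarrow> 0"
    by (simp add: measure_scalar)
  then have "(\<lambda>n. sqrt ((norm (E (?A n) x))\<^sup>2)) \<longlonglongrightarrow> sqrt 0"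
    by (intro tendsto_intros)
  then have "(\<lambda>n. E (?A n) x) \<longlonglongrightarrow> 0"
    by (simp add: tendsto_norm_zero_iff)
  moreover have "E (?A n) x = x - P n x" for n
    using E_Un[of "{- real n..real n}" "?A n" x] by (simp add: P_eq_E Un_Diff_cancel Compl_partition algebra_simps)
  ultimately have "(\<lambda>n. x - P n x) \<longlonglongrightarrow> 0" by simp
  from tendsto_diff[OF tendsto_const[of x] this] show ?thesis by simp
qed

lemma P_eqI: "(\<And>n. P n x = P n y) \<Longrightarrow> x = y"
  using LIMSEQ_unique[OF P_tendsto[of x]] P_tendsto[of y] by simp

lemma P_norm_diff: "(norm (y - P m y))\<^sup>2 = (norm y)\<^sup>2 - (norm (P m y))\<^sup>2"
proof -
  have "cinner (P m y) y = cinner (P m y) (P m y)" "cinner y (P m y) = cinner (P m y) (P m y)"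
    by (metis P_P P_sym order_refl)+
  then have "cinner (y - P m y) (y - P m y) = cinner y y - cinner (P m y) (P m y)"
    by (simp add: cinner.diff_left cinner.diff_right)
  then have "complex_of_real ((norm (y - P m y))\<^sup>2) = complex_of_real ((norm y)\<^sup>2 - (norm (P m y))\<^sup>2)"
    by (simp add: cinner_self)
  then show ?thesis using of_real_eq_iff by blast
qed

lemma Op_norm_incseq: "locally_bounded g \<Longrightarrow> incseq (\<lambda>n. norm (Op n g x))"
  by (rule incseq_SucI) (metis P_Op P_norm_le le_Suc_eq order_refl)

lemma nn_integral_cut:
  assumes "locally_bounded g"
  shows "(\<integral>\<^sup>+s. ennreal ((cut n s * g s)\<^sup>2) \<partial>scalar_measure E x) = ennreal ((norm (Op n g x))\<^sup>2)"
  unfolding Op_def Phi_norm_square[OF locally_bounded_cut[OF assms]]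
  by (rule nn_integral_eq_integral)
     (simp_all add: bounded_borel_integrable bounded_borel_power2 locally_bounded_cut assms)

text \<open>Monotone convergence: the integral of the square of \<open>g\<close> is the supremum of
  the squared norms of the truncations.\<close>

lemma spectral_domain_iff:
  assumes "locally_bounded g"
  shows "x \<in> spectral_domain E UNIV g \<longleftrightarrow> (\<exists>C. \<forall>n. norm (Op n g x) \<le> C)"
proof -
  let ?M = "scalar_measure E x"
  have [measurable]: "g \<in> borel_measurable borel" using assms by (simp add: locally_bounded_def)
  have sup: "(SUP n. ennreal ((cut n s * g s)\<^sup>2)) = ennreal ((g s)\<^sup>2)" for s
  proof (rule antisym)
    show "(SUP n. ennreal ((cut n s * g s)\<^sup>2)) \<le> ennreal ((g s)\<^sup>2)"
      by (rule SUP_least) (auto simp: indicator_def)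
    obtain n where "\<bar>s\<bar> \<le> real n" using real_arch_simple by blast
    then have "ennreal ((g s)\<^sup>2) = ennreal ((cut n s * g s)\<^sup>2)"
      by (auto simp: indicator_def)
    also have "\<dots> \<le> (SUP n. ennreal ((cut n s * g s)\<^sup>2))" by (rule SUP_upper) simp
    finally show "ennreal ((g s)\<^sup>2) \<le> (SUP n. ennreal ((cut n s * g s)\<^sup>2))" .
  qed
  have "(\<integral>\<^sup>+s\<in>UNIV. ennreal ((g s)\<^sup>2) \<partial>?M) = (\<integral>\<^sup>+s. (SUP n. ennreal ((cut n s * g s)\<^sup>2)) \<partial>?M)"
    by (simp add: sup)
  also have "\<dots> = (SUP n. \<integral>\<^sup>+s. ennreal ((cut n s * g s)\<^sup>2) \<partial>?M)"
  proof (rule nn_integral_monotone_convergence_SUP)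
    show "incseq (\<lambda>n s. ennreal ((cut n s * g s)\<^sup>2))"
      by (intro incseq_SucI le_funI) (auto simp: indicator_def)
    show "(\<lambda>s. ennreal ((cut n s * g s)\<^sup>2)) \<in> borel_measurable ?M" for n
      by measurable
  qed
  also have "\<dots> = (SUP n. ennreal ((norm (Op n g x))\<^sup>2))"
    by (simp add: nn_integral_cut assms)
  finally have "x \<in> spectral_domain E UNIV g \<longleftrightarrow> (SUP n. ennreal ((norm (Op n g x))\<^sup>2)) < \<infinity>"
    by (simp add: spectral_domain_def)
  also have "\<dots> \<longleftrightarrow> (\<exists>C. \<forall>n. norm (Op n g x) \<le> C)"
  proof
    assume *: "(SUP n. ennreal ((norm (Op n g x))\<^sup>2)) < \<infinity>"
    then obtain C where C: "(SUP n. ennreal ((norm (Op n g x))\<^sup>2)) = ennreal C" "C \<ge> 0"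
      by (cases "SUP n. ennreal ((norm (Op n g x))\<^sup>2)") auto
    have "norm (Op n g x) \<le> sqrt C" for n
    proof (rule real_le_rsqrt)
      have "ennreal ((norm (Op n g x))\<^sup>2) \<le> ennreal C" 
        unfolding C(1)[symmetric] by (rule SUP_upper) simp
      then show "(norm (Op n g x))\<^sup>2 \<le> C" using C(2) by simp
    qed
    then show "\<exists>C. \<forall>n. norm (Op n g x) \<le> C" by blast
  next
    assume "\<exists>C. \<forall>n. norm (Op n g x) \<le> C"
    then obtain C where C: "\<And>n. norm (Op n g x) \<le> C" by blast
    have "(SUP n. ennreal ((norm (Op n g x))\<^sup>2)) \<le> ennreal (C\<^sup>2)"
      by (intro SUP_least ennreal_leI power_mono C) simp
    also have "\<dots> < \<infinity>" by simp
    finally show "(SUP n. ennreal ((norm (Op n g x))\<^sup>2)) < \<infinity>" .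
  qed
  finally show ?thesis .
qed

lemma spectral_domain_shift:
  assumes "locally_bounded g" "x \<in> spectral_domain E UNIV g" "z \<in> spectral_domain E UNIV g"
  shows "x + c *\<^sub>C z \<in> spectral_domain E UNIV g"
proof -
  obtain C D where C: "\<And>n. norm (Op n g x) \<le> C" and D: "\<And>n. norm (Op n g z) \<le> D"
    using assms by (auto simp: spectral_domain_iff)
  have "norm (Op n g (x + c *\<^sub>C z)) \<le> C + cmod c * D" for n
    by (simp add: Op_linear assms(1))
       (intro norm_triangle_le add_mono C, simp add: norm_scaleC mult_left_mono D)
  then show ?thesis using assms(1) by (auto simp: spectral_domain_iff)
qed

text \<open>The domain only provides integrability of the square of \<open>g\<close>. Since the
  measure is finite, \<open>1 + (g s)\<^sup>2\<close> is integrable too and dominates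
  \<open>\<bar>g s\<bar>\<close>.\<close>

lemma spectral_domain_integral_tendsto:
  assumes "locally_bounded g" "x \<in> spectral_domain E UNIV g"
  shows "(\<lambda>n. \<integral>s. cut n s * g s \<partial>scalar_measure E x) \<longlonglongrightarrow> (\<integral>s. g s \<partial>scalar_measure E x)"
proof (rule integral_dominated_convergence)
  let ?M = "scalar_measure E x"
  have [measurable]: "g \<in> borel_measurable borel" using assms by (simp add: locally_bounded_def)
  show "g \<in> borel_measurable ?M" by measurable
  show "(\<lambda>s. cut n s * g s) \<in> borel_measurable ?M" for n by measurable
  have "integrable ?M (\<lambda>s. (g s)\<^sup>2)"
    using assms(2) by (intro integrableI_nonneg) (auto simp: spectral_domain_def)
  then show "integrable ?M (\<lambda>s. 1 + (g s)\<^sup>2)"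
    by (intro Bochner_Integration.integrable_add finite_measure.integrable_const[OF finite_scalar])
  show "AE s in ?M. (\<lambda>n. cut n s * g s) \<longlonglongrightarrow> g s"
  proof (rule AE_I2)
    fix s
    obtain n where "\<bar>s\<bar> \<le> real n" using real_arch_simple by blast
    then have "\<forall>\<^sub>F m in sequentially. cut m s * g s = g s"
      by (intro eventually_sequentiallyI[of n]) (auto simp: indicator_def)
    then show "(\<lambda>n. cut n s * g s) \<longlonglongrightarrow> g s" by (rule tendsto_eventually)
  qed
  have "\<bar>g s\<bar> \<le> 1 + (g s)\<^sup>2" for s
    using zero_le_power2[of "\<bar>g s\<bar> - 1"] by (simp add: power2_diff)
  then show "AE s in ?M. norm (cut n s * g s) \<le> 1 + (g s)\<^sup>2" for n
    by (auto simp: indicator_def)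
qed

text \<open>
  The domain and the defining form of the spectral integral enter only through this
  characterization by bounded truncations.
\<close>

theorem spectral_integral_eq_Some:
  assumes g: "locally_bounded g"
  shows "spectral_integral E UNIV g x = Some y \<longleftrightarrow> (\<forall>n. P n y = Op n g x)"
proof -
  let ?D = "spectral_domain E UNIV g"
  have dom: "x \<in> ?D" if "\<And>n. P n y = Op n g x" for x y
    unfolding spectral_domain_iff[OF g] using that P_norm_le[of _ y] by metis
  \<comment> \<open>Truncated vectors lie in the domain, by commuting two truncations. They are
    dense and serve as test vectors in the uniqueness argument below.\<close>
  have PD: "P n w \<in> ?D" for n w
    by (rule dom[of "Op n g w"]) (simp only: Op_P[OF g] P_Op_commute[OF g, of _ n])
  show ?thesis
  proof (cases "x \<in> ?D")
    case False
    then show ?thesis using dom by (auto simp: spectral_integral_def)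
  next
    case x: True
    then obtain C where C: "\<And>n. norm (Op n g x) \<le> C" using spectral_domain_iff[OF g] by blast
    have "convergent (\<lambda>n. (norm (Op n g x))\<^sup>2)"
    proof (rule Bseq_monoseq_convergent)
      have "incseq (\<lambda>n. (norm (Op n g x))\<^sup>2)"
        using Op_norm_incseq[OF g, of x] by (auto simp: incseq_def power_mono)
      then show "monoseq (\<lambda>n. (norm (Op n g x))\<^sup>2)" by (rule incseq_imp_monoseq)
      show "Bseq (\<lambda>n. (norm (Op n g x))\<^sup>2)"
        by (rule BseqI'[of _ "C\<^sup>2"]) (simp add: power_mono C)
    qed
    then have Cau: "Cauchy (\<lambda>n. (norm (Op n g x))\<^sup>2)" by (rule convergent_Cauchy)
    \<comment> \<open>Truncations differ by orthogonal increments (\<open>P_norm_diff\<close>), so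
      convergence of the increasing, bounded squared norms forces convergence of the
      vectors.\<close>
    have "Cauchy (\<lambda>n. Op n g x)"
    proof (rule metric_CauchyI)
      fix e :: real assume "0 < e"
      then obtain N where N: "\<And>m n. m \<ge> N \<Longrightarrow> n \<ge> N \<Longrightarrow>
          dist ((norm (Op m g x))\<^sup>2) ((norm (Op n g x))\<^sup>2) < e\<^sup>2"
        using metric_CauchyD[OF Cau, of "e\<^sup>2"] by auto
      have *: "norm (Op n g x - Op m g x) < e" if "N \<le> m" "m \<le> n" for m n
      proof (rule power2_less_imp_less)
        show "(norm (Op n g x - Op m g x))\<^sup>2 < e\<^sup>2"
          using N[of m n] that P_norm_diff[of "Op n g x" m]
          by (simp add: P_Op[OF g that(2)] dist_real_def)
      qed (use \<open>0 < e\<close> in simp)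
      show "\<exists>M. \<forall>m\<ge>M. \<forall>n\<ge>M. dist (Op m g x) (Op n g x) < e"
        by (intro exI[of _ N] allI impI) (metis * dist_norm norm_minus_commute nle_le)
    qed
    then obtain y0 where y0: "(\<lambda>n. Op n g x) \<longlonglongrightarrow> y0"
      by (auto simp: Cauchy_convergent_iff convergent_def)
    have Py0: "P m y0 = Op m g x" for m
    proof -
      have a: "(\<lambda>n. P m (Op n g x)) \<longlonglongrightarrow> P m y0"
        using bounded_linear.tendsto[OF Phi_bounded_linear[OF bounded_borel_cut] y0]
        by (simp add: P_def)
      have b: "\<forall>\<^sub>F n in sequentially. P m (Op n g x) = Op m g x"
        by (intro eventually_sequentiallyI[of m]) (simp add: P_Op g)
      show ?thesis by (rule LIMSEQ_unique[OF a tendsto_eventually[OF b]])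
    qed
    have form: "cinner y0 z = spectral_form E UNIV g x z" if z: "z \<in> ?D" for z
    proof -
      have "(\<lambda>n. spectral_form E UNIV (\<lambda>s. cut n s * g s) x z) \<longlonglongrightarrow> spectral_form E UNIV g x z"
        unfolding spectral_form_def set_lebesgue_integral_def
        using spectral_domain_integral_tendsto[OF g spectral_domain_shift[OF g x z]]
        by (intro tendsto_intros) simp_all
      moreover have "spectral_form E UNIV (\<lambda>s. cut n s * g s) x z = cinner (Op n g x) z" for n
        unfolding Op_def
        by (rule limit_op_form[symmetric]) (simp_all add: limit_op_Phi locally_bounded_cut g)
      moreover have "(\<lambda>n. cinner (Op n g x) z) \<longlonglongrightarrow> cinner y0 z"
        by (rule cinner.tendsto[OF y0 tendsto_const])
      ultimately show ?thesis by (simp add: LIMSEQ_unique)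
    qed
    have uniq: "y' = y0" if "\<forall>z\<in>?D. cinner y' z = spectral_form E UNIV g x z" for y'
    proof (rule P_eqI, rule cinner_eq_iff)
      fix n w
      show "cinner (P n y') w = cinner (P n y0) w"
        using that form PD[of n w] by (simp add: P_sym)
    qed
    have "spectral_integral E UNIV g x = Some y0"
      using x form uniq unfolding spectral_integral_def by (auto intro!: the_equality)
    then show ?thesis using Py0 P_eqI[of y0 y] by auto
  qed
qed

end

section \<open>Spectrum of a strictly positive operator\<close>

context pvm
begin

lemma locally_bounded_id: "locally_bounded (\<lambda>s. s)"
  by (rule locally_boundedI) auto

text \<open>A vector living on a set where \<open>g\<close> is bounded lies in the domain, and the
  bounded calculus computes its image. All test vectors near a point of the spectrum are of this
  kind.\<close>

lemma spectral_integral_bounded_range: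
  assumes g: "locally_bounded g" and B: "B \<in> sets borel" and x: "E B x = x"
    and b: "bounded_borel (\<lambda>s. indicator B s * g s)"
  shows "spectral_integral E UNIV g x = Some (Phi (\<lambda>s. indicator B s * g s) x)"
  unfolding spectral_integral_eq_Some[OF g]
proof
  fix n
  have "P n (Phi (\<lambda>s. indicator B s * g s) x) = Phi (\<lambda>s. (cut n s * g s) * indicator B s) x"
    by (simp only: P_Phi[OF b]) (simp only: mult_ac)
  also have "\<dots> = Op n g (E B x)"
    by (simp only: Phi_mult[OF locally_bounded_cut[OF g] bounded_borel_indicator[OF B]]
        Op_def Phi_indicator[OF B])
  finally show "P n (Phi (\<lambda>s. indicator B s * g s) x) = Op n g x" by (simp add: x)
qed

lemma E_null_mono:
  assumes "A \<in> sets borel" "B \<in> sets borel" "A \<subseteq> B" "E B x = 0"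
  shows "E A x = 0"
  using E_Int[OF assms(1,2), of x] assms by (simp add: Int_absorb2 E_linear)

end

locale positive_operator = pvm E
  for E :: "real set \<Rightarrow> 'h::chilbert_space \<Rightarrow> 'h" +
  fixes A :: "'h \<rightharpoonup> 'h"
  assumes A_eq: "A = spectral_integral E UNIV (\<lambda>s. s)"
    and A_pos: "strictly_positive_op A"
begin

lemma A_Some: "A x = Some y \<longleftrightarrow> (\<forall>n. P n y = Op n (\<lambda>s. s) x)"
  unfolding A_eq by (rule spectral_integral_eq_Some[OF locally_bounded_id])

lemma interval_times_bounded: "bounded_borel (\<lambda>s. indicator {a<..<b} s * s)"
proof -
  have "\<bar>indicator {a<..<b} s * s\<bar> \<le> \<bar>a\<bar> + \<bar>b\<bar>" for s by (auto simp: indicator_def)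
  then show ?thesis unfolding bounded_borel_def by (intro conjI exI allI) auto
qed

text \<open>If \<open>E\<close> vanishes near \<open>l\<close>, then \<open>1 / (s - l)\<close>, set
  to 0 on the window, is bounded by \<open>1 / \<eta>\<close> and its operator inverts
  \<open>A - l\<close>.\<close>

lemma not_in_spectrumI:
  assumes "0 < \<eta>" and null: "\<And>x. E {l - \<eta><..<l + \<eta>} x = 0"
  shows "l \<notin> real_spectrum A"
proof -
  define B where "B = {l - \<eta><..<l + \<eta>}"
  define k where "k s = indicator (- B) s / (s - l)" for s
  have Bm: "B \<in> sets borel" "- B \<in> sets borel" by (auto simp: B_def)
  have k_le: "\<bar>k s\<bar> \<le> 1 / \<eta>" for s
    using assms(1) by (auto simp: k_def B_def indicator_def field_simps abs_if)
  have km: "k \<in> borel_measurable borel" unfolding k_def using Bm by measurable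
  have bk: "bounded_borel k" using k_le km by (auto simp: bounded_borel_def)
  have k_times: "(s - l) * k s = indicator (- B) s" for s
    using assms(1) by (auto simp: k_def B_def indicator_def)
  have EmB: "E (- B) x = x" for x
    using E_Un[OF Bm, of x] null by (simp add: B_def[symmetric] Compl_partition)
  have cut_k: "Phi (\<lambda>s. cut n s * indicator (- B) s) x = P n x" for n x
    by (simp add: Phi_mult bounded_borel_indicator Bm Phi_indicator EmB P_def)
  have bid: "bounded_borel (\<lambda>s. cut n s * s)" for n
    using locally_bounded_cut[OF locally_bounded_id] .
  have surj: "A (Phi k x) = Some (x + l *\<^sub>R Phi k x)" for x
    unfolding A_Some
  proof
    fix n
    have "(\<lambda>s. (cut n s * s) * k s) = (\<lambda>s. cut n s * ((s - l) * k s) + l * (cut n s * k s))"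
      by (auto simp: algebra_simps)
    also have "\<dots> = (\<lambda>s. cut n s * indicator (- B) s + l * (cut n s * k s))"
      by (simp only: k_times)
    finally have "(\<lambda>s. (cut n s * s) * k s) = (\<lambda>s. cut n s * indicator (- B) s + l * (cut n s * k s))" .
    then have "Op n (\<lambda>s. s) (Phi k x) = Phi (\<lambda>s. cut n s * indicator (- B) s + l * (cut n s * k s)) x"
      by (simp only: Op_def Phi_mult[OF bid bk, symmetric])
    also have "\<dots> = P n x + l *\<^sub>R P n (Phi k x)"
      by (simp add: Phi_add Phi_scale bounded_borel_mult bounded_borel_scale bounded_borel_indicator
          Bm bk cut_k P_Phi)
    finally show "P n (x + l *\<^sub>R Phi k x) = Op n (\<lambda>s. s) (Phi k x)"
      by (simp add: P_linear)
  qed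
  have inj: "Phi k (z - l *\<^sub>R y) = y" if "A y = Some z" for y z
  proof (rule P_eqI)
    fix n
    have "P n (Phi k (z - l *\<^sub>R y)) = Phi k (P n z - l *\<^sub>R P n y)"
      by (simp add: P_def Phi_commute bk Phi_linear)
    also have "\<dots> = Phi k (Phi (\<lambda>s. cut n s * s - l * cut n s) y)"
      using that by (simp add: A_Some Op_def P_def Phi_diff Phi_scale bid bounded_borel_scale)
    also have "\<dots> = Phi (\<lambda>s. k s * (cut n s * s - l * cut n s)) y"
      by (simp add: Phi_mult bk bounded_borel_diff bid bounded_borel_scale)
    also have "(\<lambda>s. k s * (cut n s * s - l * cut n s)) = (\<lambda>s. cut n s * ((s - l) * k s))"
      by (auto simp: algebra_simps)
    also have "\<dots> = (\<lambda>s. cut n s * indicator (- B) s)" by (simp only: k_times)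
    finally show "P n (Phi k (z - l *\<^sub>R y)) = P n y" by (simp add: cut_k)
  qed
  have "complex_of_real l \<in> resolvent_set A"
    unfolding resolvent_set_def mem_Collect_eq scaleC_of_real
  proof
    show "bij_betw (\<lambda>x. the (A x) - l *\<^sub>R x) (dom A) UNIV"
      unfolding bij_betw_def
    proof
      show "inj_on (\<lambda>x. the (A x) - l *\<^sub>R x) (dom A)"
        by (rule inj_on_inverseI[of _ "Phi k"]) (auto simp: inj)
      have "x = the (A (Phi k x)) - l *\<^sub>R Phi k x" "Phi k x \<in> dom A" for x
        by (simp_all add: surj dom_def)
      then show "(\<lambda>x. the (A x) - l *\<^sub>R x) ` dom A = UNIV"
        by (metis (no_types, lifting) UNIV_eq_I image_eqI)
    qed
    have "norm x \<le> 1 / \<eta> * norm (the (A x) - l *\<^sub>R x)" if "x \<in> dom A" for x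
      using that inj[of x] Phi_norm_le[OF bk k_le] by (metis domD option.sel)
    then show "\<exists>C. \<forall>x\<in>dom A. norm x \<le> C * norm (the (A x) - l *\<^sub>R x)" by blast
  qed
  then show ?thesis by (simp add: real_spectrum_def spectrum_def)
qed

text \<open>On the range of a window of radius \<eta> around \<open>l\<close> the operator
  \<open>A - l\<close> has norm at most \<eta>, which contradicts a bounded inverse once \<eta> is
  small, unless that range is trivial.\<close>

lemma not_in_spectrumD:
  assumes "l \<notin> real_spectrum A"
  shows "\<exists>\<eta>>0. \<forall>x. E {l - \<eta><..<l + \<eta>} x = 0"
proof -
  obtain C where C: "\<And>x. x \<in> dom A \<Longrightarrow> norm x \<le> C * norm (the (A x) - l *\<^sub>R x)"
    using assms by (auto simp: real_spectrum_def spectrum_def resolvent_set_def scaleC_of_real)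
  \<comment> \<open>Chosen so that \<open>\<bar>C\<bar> * \<eta> \<le> 1 / 2\<close>; the added 1
    covers \<open>C = 0\<close>.\<close>
  define \<eta> where "\<eta> = 1 / (2 * (\<bar>C\<bar> + 1))"
  have \<eta>: "\<eta> > 0" "\<bar>C\<bar> * \<eta> \<le> 1 / 2" by (auto simp: \<eta>_def field_simps)
  define B where "B = {l - \<eta><..<l + \<eta>}"
  have Bm: "B \<in> sets borel" by (simp add: B_def)
  have bb: "bounded_borel (\<lambda>s. indicator B s * s)" unfolding B_def by (rule interval_times_bounded)
  have "E B y = 0" for y
  proof -
    define x where "x = E B y"
    have x: "E B x = x" by (simp add: x_def E_idem Bm)
    have Ax: "A x = Some (Phi (\<lambda>s. indicator B s * s) x)"
      unfolding A_eq by (rule spectral_integral_bounded_range[OF locally_bounded_id Bm x bb])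
    have "Phi (\<lambda>s. indicator B s * s) x - l *\<^sub>R x = Phi (\<lambda>s. indicator B s * s) x - l *\<^sub>R Phi (indicator B) x"
      by (simp add: Phi_indicator Bm x)
    also have "\<dots> = Phi (\<lambda>s. indicator B s * s - l * indicator B s) x"
      by (simp add: Phi_diff Phi_scale bb bounded_borel_scale bounded_borel_indicator Bm)
    also have "norm \<dots> \<le> \<eta> * norm x"
    proof (rule Phi_norm_le)
      show "bounded_borel (\<lambda>s. indicator B s * s - l * indicator B s)"
        by (intro bounded_borel_diff bb bounded_borel_scale bounded_borel_indicator Bm)
      show "\<bar>indicator B s * s - l * indicator B s\<bar> \<le> \<eta>" for s
        using \<eta>(1) by (auto simp: B_def indicator_def)
    qed
    finally have 1: "norm (the (A x) - l *\<^sub>R x) \<le> \<eta> * norm x" by (simp add: Ax)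
    have "norm x \<le> C * norm (the (A x) - l *\<^sub>R x)" by (rule C) (simp add: Ax domI)
    also have "\<dots> \<le> \<bar>C\<bar> * (\<eta> * norm x)"
      using 1 by (intro mult_mono) auto
    also have "\<dots> \<le> 1 / 2 * norm x"
      using mult_right_mono[OF \<eta>(2), of "norm x"] by (simp add: mult.assoc)
    finally show ?thesis by (simp add: x_def)
  qed
  then show ?thesis using \<eta>(1) B_def by blast
qed

text \<open>For \<open>l\<close> below the positivity constant \<open>c\<close>, a window of half
  the gap stays below \<open>c\<close>. The quadratic form on its range is then both smaller than
  \<open>c\<close> times the squared norm and at least that, so the range is trivial.\<close>

lemma spectrum_lower_bound: "\<exists>c>0. \<forall>s\<in>real_spectrum A. c \<le> s"
proof -
  obtain c where c: "c > 0" and pos: "\<And>x. x \<in> dom A \<Longrightarrow> c * (norm x)\<^sup>2 \<le> Re (cinner (the (A x)) x)"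
    using A_pos by (auto simp: strictly_positive_op_def)
  have "l \<notin> real_spectrum A" if "l < c" for l
  proof (rule not_in_spectrumI)
    define \<eta> where "\<eta> = (c - l) / 2"
    show "\<eta> > 0" using that by (simp add: \<eta>_def)
    define B where "B = {l - \<eta><..<l + \<eta>}"
    have Bm: "B \<in> sets borel" by (simp add: B_def)
    have bb: "bounded_borel (\<lambda>s. indicator B s * s)" unfolding B_def by (rule interval_times_bounded)
    fix y
    define x where "x = E B y"
    have x: "E B x = x" by (simp add: x_def E_idem Bm)
    have Ax: "A x = Some (Phi (\<lambda>s. indicator B s * s) x)"
      unfolding A_eq by (rule spectral_integral_bounded_range[OF locally_bounded_id Bm x bb])
    have "0 \<le> Re (cinner (Phi (\<lambda>s. (l + \<eta>) * indicator B s - indicator B s * s) x) x)"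
      by (intro Phi_quad_nonneg bounded_borel_diff bb bounded_borel_scale bounded_borel_indicator Bm)
         (auto simp: B_def indicator_def)
    also have "Phi (\<lambda>s. (l + \<eta>) * indicator B s - indicator B s * s) x
        = (l + \<eta>) *\<^sub>R x - Phi (\<lambda>s. indicator B s * s) x"
      by (simp only: Phi_diff[OF bounded_borel_scale[OF bounded_borel_indicator[OF Bm]] bb]
          Phi_scale[OF bounded_borel_indicator[OF Bm]] Phi_indicator[OF Bm] x)
    also have "Re (cinner \<dots> x) = (l + \<eta>) * (norm x)\<^sup>2 - Re (cinner (the (A x)) x)"
      by (simp add: cinner.diff_left cinner_scaleR_left cinner_self Ax)
    also have "\<dots> \<le> (l + \<eta> - c) * (norm x)\<^sup>2"
      using pos[of x] Ax by (simp add: algebra_simps domI)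
    finally have "0 \<le> (l + \<eta> - c) * (norm x)\<^sup>2" .
    moreover have "l + \<eta> - c < 0" using that by (simp add: \<eta>_def field_simps)
    ultimately have "x = 0" by (metis mult_neg_pos not_less zero_less_power2 norm_eq_zero)
    then show "E {l - \<eta><..<l + \<eta>} y = 0" by (simp add: x_def B_def)
  qed
  then show ?thesis using c by (metis not_less)
qed

text \<open>The two preceding criteria identify the complement of the spectrum with the union of the
  open intervals on which \<open>E\<close> vanishes. By Lindelof countably many suffice, and a
  countable union of null sets is null for every scalar measure.\<close>

lemma resolvent_real: "open (- real_spectrum A)" "E (- real_spectrum A) x = 0"
proof -
  define F where "F = {B. \<exists>a b. B = {a<..<b} \<and> (\<forall>x. E B x = 0)}"
  have "\<Union>F = - real_spectrum A"
  proof (intro equalityI subsetI)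
    fix l assume "l \<in> - real_spectrum A"
    then obtain \<eta> where "\<eta> > 0" "\<forall>x. E {l - \<eta><..<l + \<eta>} x = 0" using not_in_spectrumD by auto
    then show "l \<in> \<Union>F" unfolding F_def by (intro UnionI[of "{l - \<eta><..<l + \<eta>}"]) auto
  next
    fix l assume "l \<in> \<Union>F"
    then obtain a b where l: "a < l" "l < b" and n: "\<forall>x. E {a<..<b} x = 0" by (auto simp: F_def)
    have "l \<notin> real_spectrum A"
    proof (rule not_in_spectrumI)
      show "min (l - a) (b - l) > 0" using l by simp
      show "E {l - min (l - a) (b - l)<..<l + min (l - a) (b - l)} x = 0" for x
        by (rule E_null_mono[of _ "{a<..<b}"]) (use l n in auto)
    qed
    then show "l \<in> - real_spectrum A" by simp
  qed
  moreover have oF: "\<And>B. B \<in> F \<Longrightarrow> open B" by (auto simp: F_def)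
  ultimately show "open (- real_spectrum A)" by (metis open_Union)
  obtain F' where F': "F' \<subseteq> F" "countable F'" "\<Union>F' = \<Union>F"
    using Lindelof[OF oF] by metis
  have m: "B \<in> sets borel" if "B \<in> F'" for B using that F' oF by (auto intro: borel_open)
  have "(\<Union>B\<in>F'. B) \<in> null_sets (scalar_measure E x)"
  proof (rule null_sets_UN'[OF F'(2)])
    fix B assume B: "B \<in> F'"
    then have "E B x = 0" using F'(1) by (auto simp: F_def)
    then show "B \<in> null_sets (scalar_measure E x)" using m[OF B]
      by (simp add: null_sets_def emeasure_scalar)
  qed
  then have "- real_spectrum A \<in> null_sets (scalar_measure E x)"
    using \<open>\<Union>F = - real_spectrum A\<close> F'(3) by simp
  then show "E (- real_spectrum A) x = 0"
    by (auto simp: null_sets_def emeasure_scalar)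
qed

lemma closed_spectrum: "closed (real_spectrum A)"
  using resolvent_real(1) by (simp add: closed_def)

lemma spectrum_borel [measurable]: "real_spectrum A \<in> sets borel"
  by (rule borel_closed[OF closed_spectrum])

lemma E_spectrum: "E (real_spectrum A) x = x"
  using E_Un[OF spectrum_borel, of "- real_spectrum A" x] resolvent_real
  by (simp add: Compl_partition borel_open)

lemma Phi_spectrum: "bounded_borel g \<Longrightarrow> Phi (\<lambda>s. g s * indicator (real_spectrum A) s) x = Phi g x"
  by (simp add: Phi_mult bounded_borel_indicator spectrum_borel Phi_indicator E_spectrum)

text \<open>\<open>E\<close> is concentrated on the spectrum, so only values there count. This is
  what makes hypotheses on \<open>f\<close> restricted to the spectrum sufficient.\<close>

lemma Phi_cong:
  assumes "bounded_borel g" "bounded_borel k" "\<And>s. s \<in> real_spectrum A \<Longrightarrow> g s = k s"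
  shows "Phi g x = Phi k x"
proof -
  have "(\<lambda>s. g s * indicator (real_spectrum A) s) = (\<lambda>s. k s * indicator (real_spectrum A) s)"
    using assms(3) by (auto simp: indicator_def)
  then show ?thesis using Phi_spectrum[OF assms(1)] Phi_spectrum[OF assms(2)] by metis
qed

lemma Phi_nonneg_on:
  assumes "bounded_borel g" "\<And>s. s \<in> real_spectrum A \<Longrightarrow> 0 \<le> g s"
  shows "0 \<le> Re (cinner (Phi g x) x)"
proof -
  have "0 \<le> Re (cinner (Phi (\<lambda>s. g s * indicator (real_spectrum A) s) x) x)"
    by (intro Phi_quad_nonneg bounded_borel_mult assms bounded_borel_indicator spectrum_borel)
       (auto simp: indicator_def assms(2))
  then show ?thesis by (simp only: Phi_spectrum[OF assms(1)])
qed

lemma Phi_norm_le_on: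
  assumes "bounded_borel g" "\<And>s. s \<in> real_spectrum A \<Longrightarrow> \<bar>g s\<bar> \<le> M" "0 \<le> M"
  shows "norm (Phi g x) \<le> M * norm x"
proof -
  have "norm (Phi (\<lambda>s. g s * indicator (real_spectrum A) s) x) \<le> M * norm x"
    by (intro Phi_norm_le bounded_borel_mult assms bounded_borel_indicator spectrum_borel)
       (auto simp: indicator_def assms(2,3))
  then show ?thesis by (simp only: Phi_spectrum[OF assms(1)])
qed

end

section \<open>Contraction semigroups on a carrier\<close>

text \<open>
  The linear map \<open>J\<close> realizes \<open>(X, N)\<close> isometrically inside a normed space, which makes the
  library's derivatives and limits available.
\<close>

locale carrier_semigroup =
  fixes X :: "'z::complex_vector set" and N :: "'z \<Rightarrow> real" and S :: "real \<Rightarrow> 'z \<Rightarrow> 'z"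
    and J :: "'z \<Rightarrow> 'b::real_normed_vector"
  assumes semigroup: "contraction_semigroup X N S"
    and X: "csubspace X"
    and N_J: "z \<in> X \<Longrightarrow> N z = norm (J z)"
    and J_add: "z \<in> X \<Longrightarrow> w \<in> X \<Longrightarrow> J (z + w) = J z + J w"
    and J_scaleR: "z \<in> X \<Longrightarrow> J (r *\<^sub>R z) = r *\<^sub>R J z"
    and N_scaleC: "z \<in> X \<Longrightarrow> N (c *\<^sub>C z) = cmod c * N z"
    and J_zero: "z \<in> X \<Longrightarrow> J z = 0 \<Longrightarrow> z = 0"
begin

abbreviation gv :: "'z \<Rightarrow> 'z \<Rightarrow> bool" where
  "gv \<equiv> has_generator_value X N S"

lemma X_add [simp]: "z \<in> X \<Longrightarrow> w \<in> X \<Longrightarrow> z + w \<in> X"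
  and X_scaleC [simp]: "z \<in> X \<Longrightarrow> c *\<^sub>C z \<in> X"
  using X by (auto simp: csubspace_def)

lemma X_scaleR [simp]: "z \<in> X \<Longrightarrow> r *\<^sub>R z \<in> X"
  using X_scaleC[of z "complex_of_real r"] by (simp add: scaleC_of_real)

lemma X_diff [simp]: "z \<in> X \<Longrightarrow> w \<in> X \<Longrightarrow> z - w \<in> X"
  using X_add[of z "-1 *\<^sub>R w"] X_scaleR[of w "-1"] by simp

lemma J_diff: "z \<in> X \<Longrightarrow> w \<in> X \<Longrightarrow> J (z - w) = J z - J w"
  using J_add[of z "-1 *\<^sub>R w"] J_scaleR[of w "-1"] X_scaleR[of w "-1"] by simp

lemma N_triangle: "z \<in> X \<Longrightarrow> w \<in> X \<Longrightarrow> N (z + w) \<le> N z + N w"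
  by (simp add: N_J J_add norm_triangle_ineq)

lemma N_scaleR: "z \<in> X \<Longrightarrow> N (r *\<^sub>R z) = \<bar>r\<bar> * N z"
  using N_scaleC[of z "complex_of_real r"] by (simp add: scaleC_of_real)

lemma N_nonneg: "z \<in> X \<Longrightarrow> 0 \<le> N z"
  by (simp add: N_J)

lemma S_X [simp]: "t \<ge> 0 \<Longrightarrow> z \<in> X \<Longrightarrow> S t z \<in> X"
  using semigroup by (auto simp: contraction_semigroup_def)

lemma S_N_le: "t \<ge> 0 \<Longrightarrow> z \<in> X \<Longrightarrow> N (S t z) \<le> N z"
  using semigroup by (auto simp: contraction_semigroup_def)

lemma S_zero: "z \<in> X \<Longrightarrow> S 0 z = z"
  using semigroup by (auto simp: contraction_semigroup_def)

lemma S_plus: "t \<ge> 0 \<Longrightarrow> s \<ge> 0 \<Longrightarrow> z \<in> X \<Longrightarrow> S (t + s) z = S t (S s z)"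
  using semigroup by (auto simp: contraction_semigroup_def)

lemma S_add: "t \<ge> 0 \<Longrightarrow> z \<in> X \<Longrightarrow> w \<in> X \<Longrightarrow> S t (z + w) = S t z + S t w"
  and S_scaleC: "t \<ge> 0 \<Longrightarrow> z \<in> X \<Longrightarrow> S t (c *\<^sub>C z) = c *\<^sub>C S t z"
  using semigroup by (auto simp: contraction_semigroup_def clinear_on_def)

lemma S_scaleR: "t \<ge> 0 \<Longrightarrow> z \<in> X \<Longrightarrow> S t (r *\<^sub>R z) = r *\<^sub>R S t z"
  using S_scaleC[of t z "complex_of_real r"] by (simp add: scaleC_of_real)

lemma S_diff: "t \<ge> 0 \<Longrightarrow> z \<in> X \<Longrightarrow> w \<in> X \<Longrightarrow> S t (z - w) = S t z - S t w"
  using S_add[of t z "-1 *\<^sub>R w"] S_scaleR[of t w "-1"] X_scaleR[of w "-1"] by simp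

lemma S_tendsto: "z \<in> X \<Longrightarrow> ((\<lambda>t. N (S t z - z)) \<longlongrightarrow> 0) (at_right 0)"
  using semigroup by (auto simp: contraction_semigroup_def)

lemma gvD:
  assumes "gv z y"
  shows "y \<in> X" "((\<lambda>t. N ((1 / t) *\<^sub>R (S t z - z) - y)) \<longlongrightarrow> 0) (at_right 0)"
  using assms by (auto simp: has_generator_value_def)

lemma ev_pos: "\<forall>\<^sub>F h::real in at_right 0. h > 0"
  by (simp add: eventually_at_right_less)

lemma gv_unique:
  assumes "z \<in> X" "gv z y" "gv z y'"
  shows "y = y'"
proof -
  let ?D = "\<lambda>h. (1 / h) *\<^sub>R (S h z - z)"
  have "((\<lambda>h. N (?D h - y) + N (?D h - y')) \<longlongrightarrow> 0 + 0) (at_right 0)"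
    by (intro tendsto_add gvD assms)
  moreover have "\<forall>\<^sub>F h in at_right 0. N (y - y') \<le> N (?D h - y) + N (?D h - y')"
    using ev_pos
  proof eventually_elim
    case (elim h)
    have m: "?D h \<in> X" "y \<in> X" "y' \<in> X" using elim assms gvD(1) by simp_all
    have "N (y - y') = norm ((J (?D h) - J y') - (J (?D h) - J y))" using m by (simp add: N_J J_diff)
    also have "\<dots> \<le> norm (J (?D h) - J y') + norm (J (?D h) - J y)" by (rule norm_triangle_ineq4)
    finally show ?case using m by (simp add: N_J J_diff)
  qed
  ultimately have "N (y - y') \<le> 0"
    using tendsto_lowerbound[of _ 0 "at_right (0::real)"] by simp
  moreover have "y - y' \<in> X" using assms gvD(1) by simp
  ultimately show ?thesis using J_zero[of "y - y'"] by (simp add: N_J)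
qed

lemma generator_Some: "generator X N S z = Some y \<longleftrightarrow> z \<in> X \<and> gv z y"
proof -
  have "(THE y. gv z y) = y" if "z \<in> X" "gv z y" for y
    using gv_unique that by (intro the_equality) auto
  then show ?thesis by (auto simp: generator_def)
qed

text \<open>\<open>S t\<close> commutes with the difference quotients and does not increase
  \<open>N\<close>, so the quotient error at \<open>S t z\<close> is at most that at
  \<open>z\<close>.\<close>

lemma gv_S:
  assumes "z \<in> X" "gv z y" "t \<ge> 0"
  shows "gv (S t z) (S t y)"
  unfolding has_generator_value_def
proof
  show "S t y \<in> X" using assms gvD(1) by simp
  show "((\<lambda>h. N ((1 / h) *\<^sub>R (S h (S t z) - S t z) - S t y)) \<longlongrightarrow> 0) (at_right 0)"
  proof (rule tendsto_sandwich[OF _ _ tendsto_const gvD(2)[OF assms(2)]])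
    show "\<forall>\<^sub>F h in at_right 0. 0 \<le> N ((1 / h) *\<^sub>R (S h (S t z) - S t z) - S t y)"
      using ev_pos by eventually_elim (use assms gvD(1) in \<open>simp add: N_nonneg\<close>)
    show "\<forall>\<^sub>F h in at_right 0. N ((1 / h) *\<^sub>R (S h (S t z) - S t z) - S t y)
        \<le> N ((1 / h) *\<^sub>R (S h z - z) - y)"
      using ev_pos
    proof eventually_elim
      case (elim h)
      have y: "y \<in> X" using assms gvD(1) by simp
      have "S h (S t z) = S t (S h z)"
        using S_plus[of h t z] S_plus[of t h z] elim assms by (simp add: add.commute)
      then have "(1 / h) *\<^sub>R (S h (S t z) - S t z) - S t y = S t ((1 / h) *\<^sub>R (S h z - z) - y)"
        using elim assms y by (simp add: S_diff S_scaleR)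
      then show ?case using elim assms y by (simp add: S_N_le)
    qed
  qed
qed

text \<open>
  Writing \<open>B = e\<^sup>-\<^sup>i\<^sup>\<omega>\<^sup>h S(h)\<close> with \<open>h = T / n\<close>, the contraction \<open>B\<close> satisfies
  \<open>N (B\<^sup>n z - z) \<le> n N (B z - z)\<close>; then \<open>n\<close> tends to infinity.
\<close>

lemma rotated_increment_bound:
  assumes z: "z \<in> X" and gv: "gv z y" and T: "T > 0"
  shows "N (cis (- \<omega> * T) *\<^sub>C S T z - z) \<le> T * N (y - (\<i> * complex_of_real \<omega>) *\<^sub>C z)"
proof -
  let ?B = "\<lambda>h. cis (- \<omega> * h) *\<^sub>C S h z"
  let ?y = "y - (\<i> * complex_of_real \<omega>) *\<^sub>C z"
  have y: "y \<in> X" using gv gvD(1) by simp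
  \<comment> \<open>Telescoping: \<open>B^(k+1) z - z = B (B^k z - z) + (B z - z)\<close>, where the
    contraction \<open>B\<close> does not enlarge the first term.\<close>
  have iter: "N (cis (- \<omega> * (real k * h)) *\<^sub>C S (real k * h) z - z) \<le> real k * N (?B h - z)"
    if h: "h > 0" for h k
  proof (induction k)
    case 0
    then show ?case using z N_scaleC[of z 0] by (simp add: S_zero)
  next
    case (Suc k)
    let ?c = "cis (- \<omega> * h)" and ?d = "cis (- \<omega> * (real k * h))"
    let ?w = "?d *\<^sub>C S (real k * h) z"
    have kh: "real k * h \<ge> 0" using h by simp
    have "cis (- \<omega> * (real (Suc k) * h)) = ?c * ?d"
      by (simp add: cis_mult algebra_simps)
    moreover have "S (real (Suc k) * h) z = S h (S (real k * h) z)"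
      using S_plus[of h "real k * h" z] h z by (simp add: algebra_simps)
    ultimately have "cis (- \<omega> * (real (Suc k) * h)) *\<^sub>C S (real (Suc k) * h) z - z
        = ?c *\<^sub>C S h (?w - z) + (?B h - z)"
      using h z kh by (simp add: S_diff S_scaleC scaleC_diff_right scaleC_scaleC)
    also have "N \<dots> \<le> N (?c *\<^sub>C S h (?w - z)) + N (?B h - z)"
      using h z kh by (intro N_triangle) auto
    also have "N (?c *\<^sub>C S h (?w - z)) \<le> N (?w - z)"
      using h z kh by (simp add: N_scaleC S_N_le)
    also have "N (?w - z) \<le> real k * N (?B h - z)" by (rule Suc)
    finally show ?case by (simp add: algebra_simps)
  qed
  have diff: "((\<lambda>h. (cis (- \<omega> * h) - 1) / complex_of_real h) \<longlongrightarrow> - \<i> * complex_of_real \<omega>) (at_right 0)"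
  proof -
    let ?c = "- \<i> * complex_of_real \<omega>"
    have "((\<lambda>w. exp (w * ?c)) has_field_derivative ?c) (at 0)"
      by (auto intro!: derivative_eq_intros)
    then have "((\<lambda>w. (exp (w * ?c) - 1) / w) \<longlongrightarrow> ?c) (at 0)"
      by (simp add: has_field_derivative_iff)
    moreover have "filterlim complex_of_real (at 0) (at_right 0)"
      unfolding filterlim_at by (auto intro!: tendsto_eq_intros simp: eventually_at_filter)
    ultimately have "((\<lambda>h. (exp (complex_of_real h * ?c) - 1) / complex_of_real h) \<longlongrightarrow> ?c) (at_right 0)"
      by (rule filterlim_compose)
    then show ?thesis by (simp add: cis_conv_exp mult_ac)
  qed
  \<comment> \<open>The rotated quotient differs from \<open>?y\<close> by three errors: the
    generator quotient at \<open>z\<close>, the rotation of \<open>y\<close>, and the difference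
    quotient of the phase acting on \<open>z\<close>.\<close>
  have G: "((\<lambda>h. N ((1 / h) *\<^sub>R (?B h - z))) \<longlongrightarrow> N ?y) (at_right 0)"
  proof -
    have cis1: "((\<lambda>h. cis (- \<omega> * h)) \<longlongrightarrow> 1) (at_right 0)"
      unfolding cis_conv_exp by (auto intro!: tendsto_eq_intros)
    let ?e = "\<lambda>h. (cis (- \<omega> * h) - 1) / complex_of_real h + \<i> * complex_of_real \<omega>"
    have "((\<lambda>h. N ((1 / h) *\<^sub>R (S h z - z) - y) + cmod (cis (- \<omega> * h) - 1) * N y + cmod (?e h) * N z)
        \<longlongrightarrow> 0 + cmod (1 - 1) * N y + cmod (- \<i> * complex_of_real \<omega> + \<i> * complex_of_real \<omega>) * N z)
        (at_right 0)"
      by (intro tendsto_add tendsto_mult tendsto_norm tendsto_diff tendsto_const gvD[OF gv] diff cis1)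
    then have "((\<lambda>h. N ((1 / h) *\<^sub>R (S h z - z) - y) + cmod (cis (- \<omega> * h) - 1) * N y + cmod (?e h) * N z)
        \<longlongrightarrow> 0) (at_right 0)" by simp
    moreover have "\<forall>\<^sub>F h in at_right 0. norm (N ((1 / h) *\<^sub>R (?B h - z)) - N ?y)
        \<le> N ((1 / h) *\<^sub>R (S h z - z) - y) + cmod (cis (- \<omega> * h) - 1) * N y + cmod (?e h) * N z"
      using ev_pos
    proof eventually_elim
      case (elim h)
      let ?c = "cis (- \<omega> * h)"
      let ?a = "(1 / h) *\<^sub>R (?B h - z)"
      let ?u1 = "?c *\<^sub>C ((1 / h) *\<^sub>R (S h z - z) - y)" and ?u2 = "(?c - 1) *\<^sub>C y"
        and ?u3 = "?e h *\<^sub>C z"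
      have m: "?a \<in> X" "?y \<in> X" "?u1 \<in> X" "?u2 \<in> X" "?u3 \<in> X" using elim z y by simp_all
      have "?a - ?y = ?u1 + ?u2 + ?u3"
        by (simp add: scaleC_of_real[symmetric] scaleC_diff_right scaleC_diff_left scaleC_add_left scaleC_add_right
            scaleC_scaleC algebra_simps diff_divide_distrib)
      then have "N (?a - ?y) \<le> N ?u1 + N ?u2 + N ?u3"
        using N_triangle[of "?u1 + ?u2" ?u3] N_triangle[of ?u1 ?u2] m by simp
      moreover have "norm (N ?a - N ?y) \<le> N (?a - ?y)"
        using m norm_triangle_ineq3[of "J ?a" "J ?y"] by (simp add: N_J J_diff)
      ultimately show ?case using elim z y by (simp add: N_scaleC)
    qed
    ultimately have "((\<lambda>h. N ((1 / h) *\<^sub>R (?B h - z)) - N ?y) \<longlongrightarrow> 0) (at_right 0)"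
      by (rule Lim_null_comparison[rotated])
    then show ?thesis by (simp add: LIM_zero_iff)
  qed
  have lim: "filterlim (\<lambda>n. T / real (Suc n)) (at_right 0) sequentially"
    unfolding filterlim_at
  proof
    have "(\<lambda>n. T * inverse (real (Suc n))) \<longlonglongrightarrow> T * 0"
      by (intro tendsto_mult tendsto_const LIMSEQ_inverse_real_of_nat)
    then show "(\<lambda>n. T / real (Suc n)) \<longlonglongrightarrow> 0" by (simp add: divide_inverse)
  qed (use T in simp)
  have "(\<lambda>n. T * N ((1 / (T / real (Suc n))) *\<^sub>R (?B (T / real (Suc n)) - z))) \<longlonglongrightarrow> T * N ?y"
    by (intro tendsto_mult tendsto_const filterlim_compose[OF G lim])
  moreover have "N (cis (- \<omega> * T) *\<^sub>C S T z - z)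
      \<le> T * N ((1 / (T / real (Suc n))) *\<^sub>R (?B (T / real (Suc n)) - z))" for n
  proof -
    define h where "h = T / real (Suc n)"
    have h: "h > 0" "real (Suc n) * h = T" using T by (simp_all add: h_def del: of_nat_Suc)
    have "N (cis (- \<omega> * T) *\<^sub>C S T z - z) \<le> real (Suc n) * N (?B h - z)"
      using iter[OF h(1), of "Suc n"] by (simp only: h(2))
    also have "\<dots> = T * N ((1 / h) *\<^sub>R (?B h - z))"
      unfolding h(2)[symmetric] using h(1) z by (simp add: N_scaleR del: of_nat_Suc)
    finally show ?thesis by (simp only: h_def)
  qed
  ultimately show ?thesis by (intro LIMSEQ_le_const) auto
qed

text \<open>The generator only gives the right derivative at 0. For \<open>s > t\<close> the
  increment factors through \<open>S t\<close>; for \<open>s < t\<close> it factors through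
  \<open>S s\<close>, and then \<open>S h y\<close> appears in place of \<open>y\<close>, which
  strong continuity repairs.\<close>

lemma S_vector_derivative:
  assumes z: "z \<in> X" and gv: "gv z y" and t: "t \<ge> 0"
  shows "((\<lambda>t. J (S t z)) has_vector_derivative J (S t y)) (at t within {0..})"
proof -
  have y: "y \<in> X" using gv gvD(1) by simp
  \<comment> \<open>One bound for both sides; its second summand is used only for increments to the
    left.\<close>
  define b where "b h = N ((1 / h) *\<^sub>R (S h z - z) - y) + N (S h y - y)" for h
  have "(b \<longlongrightarrow> 0 + 0) (at_right 0)" unfolding b_def
    by (intro tendsto_add gvD[OF gv] S_tendsto y)
  then have b0: "(b \<longlongrightarrow> 0) (at_right 0)" by simp
  have step: "norm (J (S h z) - J z - h *\<^sub>R J y) = h * N ((1 / h) *\<^sub>R (S h z - z) - y)" if "h > 0" for h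
  proof -
    have "J (S h z) - J z - h *\<^sub>R J y = h *\<^sub>R J ((1 / h) *\<^sub>R (S h z - z) - y)"
      using that z y by (simp add: J_diff J_scaleR scaleR_diff_right)
    then show ?thesis using that z y by (simp add: N_J)
  qed
  have bound: "norm (J (S s z) - J (S t z) - (s - t) *\<^sub>R J (S t y)) \<le> \<bar>s - t\<bar> * b \<bar>s - t\<bar>"
    if s: "s \<ge> 0" "s \<noteq> t" for s
  proof (cases "s > t")
    case True
    define h where "h = s - t"
    have h: "h > 0" "s = t + h" using True by (auto simp: h_def)
    have e: "S s z - S t z - h *\<^sub>R S t y = S t (S h z - z - h *\<^sub>R y)"
      using h t z y by (simp add: S_plus S_diff S_scaleR)
    have "norm (J (S s z) - J (S t z) - h *\<^sub>R J (S t y)) = N (S s z - S t z - h *\<^sub>R S t y)"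
      using s(1) t z y by (simp add: N_J J_diff J_scaleR)
    also have "\<dots> \<le> N (S h z - z - h *\<^sub>R y)" unfolding e using h t z y by (simp add: S_N_le)
    also have "\<dots> = norm (J (S h z) - J z - h *\<^sub>R J y)" using h z y by (simp add: N_J J_diff J_scaleR)
    also have "\<dots> \<le> h * b h" unfolding step[OF h(1)] b_def
      using h y by (intro mult_left_mono) (auto simp: N_nonneg)
    finally show ?thesis using True unfolding h_def by simp
  next
    case False
    define h where "h = t - s"
    have h: "h > 0" "t = s + h" using False s by (auto simp: h_def)
    have e: "S s z - S t z + h *\<^sub>R S t y = S s ((h *\<^sub>R y - (S h z - z)) + h *\<^sub>R (S h y - y))"
      using h s z y by (simp add: S_plus S_diff S_add S_scaleR scaleR_diff_right)
    have "norm (J (S s z) - J (S t z) - (s - t) *\<^sub>R J (S t y)) = N (S s z - S t z + h *\<^sub>R S t y)"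
      using s(1) t z y by (simp add: N_J J_diff J_add J_scaleR h_def algebra_simps)
    also have "\<dots> \<le> N ((h *\<^sub>R y - (S h z - z)) + h *\<^sub>R (S h y - y))"
      unfolding e using h s z y by (simp add: S_N_le)
    also have "\<dots> \<le> N (h *\<^sub>R y - (S h z - z)) + N (h *\<^sub>R (S h y - y))"
      using h z y by (intro N_triangle) auto
    also have "N (h *\<^sub>R y - (S h z - z)) = norm (J (S h z) - J z - h *\<^sub>R J y)"
      using h z y by (subst norm_minus_commute[symmetric]) (simp add: N_J J_diff J_scaleR norm_minus_commute)
    also have "N (h *\<^sub>R (S h y - y)) = h * N (S h y - y)"
      using h y by (simp add: N_scaleR)
    finally have "norm (J (S s z) - J (S t z) - (s - t) *\<^sub>R J (S t y)) \<le> h * b h"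
      unfolding step[OF h(1)] b_def by (simp only: distrib_left)
    then show ?thesis using False unfolding h_def by simp
  qed
  have "((\<lambda>s. b \<bar>s - t\<bar>) \<longlongrightarrow> 0) (at t within {0..})"
  proof (rule filterlim_compose[OF b0])
    show "filterlim (\<lambda>s. \<bar>s - t\<bar>) (at_right 0) (at t within {0..})"
      unfolding filterlim_at
      by (auto intro!: tendsto_eq_intros simp: eventually_at_filter)
  qed
  then have "((\<lambda>s. norm (J (S s z) - J (S t z) - (s - t) *\<^sub>R J (S t y)) / norm (s - t)) \<longlongrightarrow> 0) (at t within {0..})"
  proof (rule tendsto_sandwich[OF _ _ tendsto_const, rotated 2])
    show "\<forall>\<^sub>F s in at t within {0..}. norm (J (S s z) - J (S t z) - (s - t) *\<^sub>R J (S t y)) / norm (s - t) \<le> b \<bar>s - t\<bar>"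
      unfolding eventually_at_filter using bound
      by (intro always_eventually) (auto simp: pos_divide_le_eq mult.commute)
  qed simp
  then show ?thesis
    by (simp add: has_vector_derivative_def has_derivative_iff_norm bounded_linear_scaleR_left)
qed

end

section \<open>The damped equation\<close>

lemma cinner_eq_iff_right: "(\<And>z. cinner z x = cinner z y) \<Longrightarrow> x = (y::'a::complex_inner)"
  by (rule cinner_eq_iff) (metis cinner_commute)

text \<open>Removes the accuracy \<open>e\<close> of approximate eigenvectors from an
  estimate.\<close>

lemma le_zero_of_small_multiples:
  fixes x C :: real
  assumes "0 < e0" "\<And>e. 0 < e \<Longrightarrow> e \<le> e0 \<Longrightarrow> x \<le> C * e"
  shows "x \<le> 0"
proof (rule tendsto_lowerbound[of "\<lambda>e. C * e" 0 "at_right 0"])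
  show "((\<lambda>e. C * e) \<longlongrightarrow> 0) (at_right 0)" by (auto intro!: tendsto_eq_intros)
  show "\<forall>\<^sub>F e in at_right 0. x \<le> C * e"
    unfolding eventually_at_right_field using assms by (intro exI[of _ e0]) auto
qed simp

locale damped = positive_operator E A
  for E :: "real set \<Rightarrow> 'h::chilbert_space \<Rightarrow> 'h" and A :: "'h \<rightharpoonup> 'h" +
  fixes f :: "real \<Rightarrow> real"
  assumes f_continuous: "continuous_on (real_spectrum A) f"
    and f_nonneg: "s \<in> real_spectrum A \<Longrightarrow> 0 \<le> f s"
begin

abbreviation spec :: "real set" where "spec \<equiv> real_spectrum A"
text \<open>Extension by zero: continuity and sign are known only on the spectrum, while the
  calculus works with functions on the whole line.\<close>

definition rt :: "real \<Rightarrow> real" where "rt s = indicator spec s * s powr (1 / 2)"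
definition fs :: "real \<Rightarrow> real" where "fs s = indicator spec s * f s"
definition root :: "'h \<rightharpoonup> 'h" where "root = functional_calculus A E (\<lambda>s. s powr (1 / 2))"
definition fA :: "'h \<rightharpoonup> 'h" where "fA = functional_calculus A E f"

lemma spec_pos: "s \<in> spec \<Longrightarrow> 0 < s"
  using spectrum_lower_bound by force

text \<open>The spectrum is closed, so its part in each window is compact and the continuous
  function is bounded there.\<close>

lemma locally_bounded_continuous:
  assumes "continuous_on spec g"
  shows "locally_bounded (\<lambda>s. indicator spec s * g s)"
proof (rule locally_boundedI)
  show "(\<lambda>s. indicator spec s * g s) \<in> borel_measurable borel"
    using borel_measurable_continuous_on_indicator[OF spectrum_borel assms] by simp
  fix n
  have "compact (spec \<inter> {- real n..real n})"
    by (rule closed_Int_compact[OF closed_spectrum]) simp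
  then have "bounded (g ` (spec \<inter> {- real n..real n}))"
    by (intro compact_imp_bounded compact_continuous_image continuous_on_subset[OF assms]) auto
  then obtain M where M: "\<forall>s\<in>spec \<inter> {- real n..real n}. \<bar>g s\<bar> \<le> M"
    unfolding bounded_iff by auto
  have "\<bar>indicator spec s * g s\<bar> \<le> \<bar>M\<bar>" if "\<bar>s\<bar> \<le> real n" for s
    using bspec[OF M, of s] that by (cases "s \<in> spec") (auto simp: abs_le_iff)
  then show "\<exists>M. \<forall>s. \<bar>s\<bar> \<le> real n \<longrightarrow> \<bar>indicator spec s * g s\<bar> \<le> M" by blast
qed

lemma lb_rt: "locally_bounded rt"
  unfolding rt_def using spec_pos
  by (intro locally_bounded_continuous continuous_intros) force+

lemma lb_fs: "locally_bounded fs"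
  unfolding fs_def by (rule locally_bounded_continuous[OF f_continuous])

lemma root_Some: "root u = Some a \<longleftrightarrow> (\<forall>n. P n a = Op n rt u)"
  using spectral_integral_eq_Some[OF lb_rt]
  unfolding root_def functional_calculus_def spectral_integral_indicator[of E spec] rt_def .

lemma fA_Some: "fA u = Some a \<longleftrightarrow> (\<forall>n. P n a = Op n fs u)"
  using spectral_integral_eq_Some[OF lb_fs]
  unfolding fA_def functional_calculus_def spectral_integral_indicator[of E spec] fs_def .

lemma Op_rt_Op_rt: "Op n rt (Op n rt u) = Op n (\<lambda>s. s) u"
proof -
  have "Op n rt (Op n rt u) = Phi (\<lambda>s. (cut n s * rt s) * (cut n s * rt s)) u"
    by (simp only: Op_def Phi_mult[OF locally_bounded_cut[OF lb_rt] locally_bounded_cut[OF lb_rt]])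
  also have "\<dots> = Op n (\<lambda>s. s) u" unfolding Op_def
  proof (rule Phi_cong)
    fix s assume s: "s \<in> spec"
    then have "s powr (1 / 2) * s powr (1 / 2) = s" using spec_pos[OF s] by (simp add: powr_add[symmetric])
    then show "(cut n s * rt s) * (cut n s * rt s) = cut n s * s"
      using s by (simp add: rt_def indicator_def)
  qed (intro bounded_borel_mult locally_bounded_cut lb_rt locally_bounded_id)+
  finally show ?thesis .
qed

text \<open>Expresses the energy inner product through truncations of \<open>A\<close>, although
  \<open>u\<close> and \<open>v\<close> are only in the domain of the square root.\<close>

lemma root_inner:
  assumes "root u = Some a" "root v = Some b"
  shows "cinner (P n b) a = cinner (Op n (\<lambda>s. s) v) u"
proof -
  have "cinner (P n b) a = cinner (P n b) (P n a)" by (metis P_P P_sym order_refl)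
  also have "\<dots> = cinner (Op n rt v) (Op n rt u)" using assms by (simp add: root_Some)
  also have "\<dots> = cinner (Op n (\<lambda>s. s) v) u" by (metis Op_sym lb_rt Op_rt_Op_rt)
  finally show ?thesis .
qed

lemma root_P: "root (P n w) = Some (Op n rt w)"
  unfolding root_Some by (simp add: Op_P lb_rt P_Op_commute[of _ n])

lemma A_P: "A (P n w) = Some (Op n (\<lambda>s. s) w)"
  unfolding A_Some by (simp add: Op_P locally_bounded_id P_Op_commute[of _ n])

lemma fA_P: "fA (P n w) = Some (Op n fs w)"
  unfolding fA_Some by (simp add: Op_P lb_fs P_Op_commute[of _ n])

lemma root_add: "root u = Some a \<Longrightarrow> root v = Some b \<Longrightarrow> root (u + v) = Some (a + b)"
  by (simp add: root_Some P_linear Op_linear lb_rt)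

lemma root_scaleC: "root u = Some a \<Longrightarrow> root (c *\<^sub>C u) = Some (c *\<^sub>C a)"
  by (simp add: root_Some P_linear Op_linear lb_rt)

lemma root_scaleR: "root u = Some a \<Longrightarrow> root (r *\<^sub>R u) = Some (r *\<^sub>R a)"
  by (simp add: root_Some P_linear Op_linear lb_rt)

lemma root_zero: "root 0 = Some 0"
  by (simp add: root_Some P_linear Op_linear lb_rt)

text \<open>The spectrum stays away from 0, so the inverse square root is bounded. It bounds the
  norm of \<open>u\<close> by its energy norm and recovers \<open>u\<close> from its energy
  coordinate.\<close>

lemma root_left_inverse: "\<exists>Q. bounded_linear Q \<and> (\<forall>u a. root u = Some a \<longrightarrow> Q a = u)"
proof -
  define q where "q s = indicator spec s * s powr (- 1 / 2)" for s
  obtain c where c: "c > 0" "\<And>s. s \<in> spec \<Longrightarrow> c \<le> s" using spectrum_lower_bound by blast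
  have "locally_bounded q"
    unfolding q_def using spec_pos by (intro locally_bounded_continuous continuous_intros) force+
  moreover have "\<bar>q s\<bar> \<le> c powr (- 1 / 2)" for s
    using c(1) c(2)[of s] by (auto simp: q_def indicator_def intro: powr_mono2')
  ultimately have q: "bounded_borel q"
    unfolding bounded_borel_def locally_bounded_def by blast
  have "Phi q a = u" if "root u = Some a" for u a
  proof (rule P_eqI)
    fix n
    have "P n (Phi q a) = Phi q (Op n rt u)"
      using that by (simp add: P_def Phi_commute q root_Some)
    also have "\<dots> = Phi (\<lambda>s. q s * (cut n s * rt s)) u"
      by (simp only: Op_def Phi_mult[OF q locally_bounded_cut[OF lb_rt]])
    also have "\<dots> = P n u" unfolding P_def
    proof (rule Phi_cong)
      fix s assume s: "s \<in> spec"
      then have "s powr (- 1 / 2) * s powr (1 / 2) = 1"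
        using spec_pos[OF s] by (simp add: powr_add[symmetric])
      then show "q s * (cut n s * rt s) = cut n s"
        using s by (simp add: q_def rt_def indicator_def)
    qed (intro bounded_borel_mult q locally_bounded_cut lb_rt bounded_borel_cut)+
    finally show "P n (Phi q a) = P n u" .
  qed
  then show ?thesis using Phi_bounded_linear[OF q] by blast
qed

lemma root_inj: "root u = Some 0 \<Longrightarrow> u = 0"
  using root_left_inverse by (metis linear_simps(3))

text \<open>Energy coordinates: \<open>N\<close> becomes the product norm of two copies of the
  Hilbert space.\<close>

definition J :: "'h \<times> 'h \<Rightarrow> 'h \<times> 'h" where
  "J z = (the (root (fst z)), snd z)"

lemma phase_space_iff: "z \<in> phase_space A E \<longleftrightarrow> (\<exists>a. root (fst z) = Some a)"
  by (cases z) (auto simp: phase_space_def power_space_def root_def dom_def)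

lemma phase_norm_eq: "root u = Some a \<Longrightarrow> phase_norm A E (u, v) = sqrt ((norm a)\<^sup>2 + (norm v)\<^sup>2)"
  by (simp add: phase_norm_def power_norm_def root_def)

lemma carrier_semigroupI:
  assumes "contraction_semigroup (phase_space A E) (phase_norm A E) S"
  shows "carrier_semigroup (phase_space A E) (phase_norm A E) S J"
proof
  show "csubspace (phase_space A E)"
    unfolding csubspace_def
    by (auto simp: phase_space_iff scaleC_prod_def root_zero) (metis root_add, metis root_scaleC)
  fix z w :: "'h \<times> 'h" assume z: "z \<in> phase_space A E"
  then obtain a where a: "root (fst z) = Some a" by (auto simp: phase_space_iff)
  show "phase_norm A E z = norm (J z)"
    using phase_norm_eq[OF a, of "snd z"] by (simp add: J_def a norm_prod_def)
  show "J (r *\<^sub>R z) = r *\<^sub>R J z" for r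
    by (simp add: J_def a root_scaleR[OF a] scaleR_prod_def)
  show "phase_norm A E (c *\<^sub>C z) = cmod c * phase_norm A E z" for c
    using phase_norm_eq[OF a, of "snd z"] phase_norm_eq[OF root_scaleC[OF a, of c], of "c *\<^sub>C snd z"]
    by (simp add: scaleC_prod_def norm_scaleC power_mult_distrib distrib_left[symmetric]
        real_sqrt_mult)
  show "J z = 0 \<Longrightarrow> z = 0"
    using root_inj[of "fst z"] a by (auto simp: J_def prod_eq_iff)
  assume "w \<in> phase_space A E"
  then obtain b where b: "root (fst w) = Some b" by (auto simp: phase_space_iff)
  show "J (z + w) = J z + J w" by (simp add: J_def a b root_add[OF a b])
qed (fact assms)

text \<open>Truncated vectors lie in both domains, so testing with them turns the dual functional
  into bounded operators. Conversely, the truncated identities pass to the limit against any test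
  vector.\<close>

lemma weak_sum_iff:
  "weak_sum A fA u v h \<longleftrightarrow> (\<forall>n. P n h = Op n (\<lambda>s. s) u + Op n fs v)"
proof
  assume w: "weak_sum A fA u v h"
  show "\<forall>n. P n h = Op n (\<lambda>s. s) u + Op n fs v"
  proof (intro allI cinner_eq_iff_right)
    fix n x
    have "P n x \<in> dom A \<inter> dom fA" using A_P fA_P by blast
    with w have "cinner (Op n (\<lambda>s. s) x) u + cinner (Op n fs x) v = cinner (P n x) h"
      unfolding weak_sum_def by (metis A_P fA_P option.sel)
    then show "cinner x (P n h) = cinner x (Op n (\<lambda>s. s) u + Op n fs v)"
      by (simp add: Op_sym locally_bounded_id lb_fs P_sym cinner_add_right)
  qed
next
  assume h: "\<forall>n. P n h = Op n (\<lambda>s. s) u + Op n fs v"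
  show "weak_sum A fA u v h"
    unfolding weak_sum_def
  proof
    fix w assume "w \<in> dom A \<inter> dom fA"
    then obtain a b where a: "A w = Some a" and b: "fA w = Some b" by auto
    have "(\<lambda>n. cinner (P n a) u + cinner (P n b) v) \<longlonglongrightarrow> cinner a u + cinner b v"
      by (intro tendsto_add cinner.tendsto P_tendsto tendsto_const)
    moreover have "cinner (P n a) u + cinner (P n b) v = cinner w (P n h)" for n
      using a b h by (simp add: A_Some fA_Some Op_sym locally_bounded_id lb_fs cinner_add_right)
    moreover have "(\<lambda>n. cinner w (P n h)) \<longlonglongrightarrow> cinner w h"
      by (intro cinner.tendsto P_tendsto tendsto_const)
    ultimately show "cinner (the (A w)) u + cinner (the (fA w)) v = cinner w h"
      using a b LIMSEQ_unique by auto
  qed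
qed

lemma weak_sum_unique: "weak_sum A fA u v h \<Longrightarrow> weak_sum A fA u v h' \<Longrightarrow> h = h'"
  by (rule P_eqI) (simp add: weak_sum_iff)

lemma damped_operator_Some:
  "damped_operator A E f (u, v) = Some (v', k) \<longleftrightarrow>
    u \<in> dom root \<and> v \<in> dom root \<and> v' = v \<and> weak_sum A fA u v (- k)"
proof -
  have "(THE h. weak_sum A fA u v h) = h" if "weak_sum A fA u v h" for h
    using that weak_sum_unique by blast
  moreover have "power_space A E 1 = dom root" by (simp add: power_space_def root_def)
  ultimately show ?thesis
    unfolding damped_operator_def phase_space_def fA_def[symmetric]
    by (auto, metis weak_sum_unique minus_minus)
qed

section \<open>Approximate eigenvectors\<close>

lemma locally_bounded_interval:
  assumes "locally_bounded g"
  shows "bounded_borel (\<lambda>s. indicator {a<..<b} s * g s)"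
proof -
  obtain n where n: "\<bar>a\<bar> + \<bar>b\<bar> \<le> real n" using real_arch_simple by blast
  have "(\<lambda>s. indicator {a<..<b} s * g s) = (\<lambda>s. indicator {a<..<b} s * (cut n s * g s))"
    by (rule ext) (use n in \<open>auto simp: indicator_def\<close>)
  then show ?thesis
    by (simp add: bounded_borel_mult bounded_borel_indicator locally_bounded_cut assms)
qed

text \<open>At a point of the spectrum every window has nonzero range. A unit vector in a small
  window makes \<open>A\<close>, \<open>fA\<close> and the square root nearly scalar
  simultaneously.\<close>

lemma approximate_eigenvector:
  assumes l: "l \<in> spec" and e: "e > 0"
  shows "\<exists>w a b r. norm w = 1 \<and> A w = Some a \<and> fA w = Some b \<and> root w = Some r \<and>
    norm (a - l *\<^sub>R w) \<le> e \<and> norm (b - f l *\<^sub>R w) \<le> e \<and> l - e \<le> (norm r)\<^sup>2 \<and> (norm r)\<^sup>2 \<le> l + e"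
proof -
  obtain d where d: "d > 0" "\<And>s. s \<in> spec \<Longrightarrow> dist s l < d \<Longrightarrow> dist (f s) (f l) < e"
    using f_continuous l e unfolding continuous_on_iff by blast
  define \<eta> where "\<eta> = min d e"
  have \<eta>: "\<eta> > 0" "\<eta> \<le> d" "\<eta> \<le> e" using d e by (auto simp: \<eta>_def)
  define B where "B = {l - \<eta><..<l + \<eta>}"
  have Bm: "B \<in> sets borel" by (simp add: B_def)
  obtain y where y: "E B y \<noteq> 0" using not_in_spectrumI[OF \<eta>(1)] l unfolding B_def by blast
  define w where "w = (1 / norm (E B y)) *\<^sub>R E B y"
  have w: "norm w = 1" "E B w = w" using y by (simp_all add: w_def E_linear E_idem Bm)
  have bb: "bounded_borel (\<lambda>s. indicator B s * g s)" if "locally_bounded g" for g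
    unfolding B_def by (rule locally_bounded_interval[OF that])
  have near: "norm (Phi (\<lambda>s. indicator B s * g s) w - g l *\<^sub>R w) \<le> e"
    if g: "locally_bounded g" and ge: "\<And>s. s \<in> spec \<Longrightarrow> s \<in> B \<Longrightarrow> \<bar>g s - g l\<bar> \<le> e" for g
  proof -
    have "Phi (\<lambda>s. indicator B s * g s) w - g l *\<^sub>R w = Phi (\<lambda>s. indicator B s * g s) w - g l *\<^sub>R Phi (indicator B) w"
      by (simp add: Phi_indicator Bm w)
    also have "\<dots> = Phi (\<lambda>s. indicator B s * g s - g l * indicator B s) w"
      by (simp add: Phi_diff Phi_scale bb g bounded_borel_scale bounded_borel_indicator Bm)
    also have "norm \<dots> \<le> e * norm w"
      by (intro Phi_norm_le_on bounded_borel_diff bb g bounded_borel_scale bounded_borel_indicator Bm)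
         (use ge e in \<open>auto simp: indicator_def\<close>)
    finally show ?thesis by (simp add: w)
  qed
  define a where "a = Phi (\<lambda>s. indicator B s * s) w"
  define b where "b = Phi (\<lambda>s. indicator B s * fs s) w"
  define r where "r = Phi (\<lambda>s. indicator B s * rt s) w"
  have Aw: "A w = Some a" unfolding A_eq a_def
    by (rule spectral_integral_bounded_range[OF locally_bounded_id Bm w(2) bb[OF locally_bounded_id]])
  have fw: "fA w = Some b"
    unfolding fA_def functional_calculus_def spectral_integral_indicator[of E spec] b_def
    using spectral_integral_bounded_range[OF lb_fs Bm w(2) bb[OF lb_fs]] by (simp add: fs_def[abs_def])
  have rw: "root w = Some r"
    unfolding root_def functional_calculus_def spectral_integral_indicator[of E spec] r_def
    using spectral_integral_bounded_range[OF lb_rt Bm w(2) bb[OF lb_rt]] by (simp add: rt_def[abs_def])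
  have a: "norm (a - l *\<^sub>R w) \<le> e"
    unfolding a_def by (rule near[OF locally_bounded_id]) (use \<eta> in \<open>auto simp: B_def\<close>)
  have "norm (b - fs l *\<^sub>R w) \<le> e"
    unfolding b_def
  proof (rule near[OF lb_fs])
    fix s assume s: "s \<in> spec" "s \<in> B"
    then have "dist s l < d" using \<eta> by (auto simp: B_def dist_real_def abs_if)
    from d(2)[OF s(1) this] show "\<bar>fs s - fs l\<bar> \<le> e"
      using s l by (simp add: fs_def dist_real_def)
  qed
  then have b: "norm (b - f l *\<^sub>R w) \<le> e" using l by (simp add: fs_def)
  \<comment> \<open>Truncation carries \<open>root_inner\<close> to the limit: the squared energy
    norm of \<open>w\<close> is \<open>\<langle>A w, w\<rangle>\<close>, which is within
    \<open>e\<close> of \<open>l\<close>.\<close>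
  have "complex_of_real ((norm r)\<^sup>2) = cinner a w"
  proof (rule LIMSEQ_unique)
    show "(\<lambda>n. cinner (P n r) r) \<longlonglongrightarrow> complex_of_real ((norm r)\<^sup>2)"
      unfolding cinner_self[symmetric] by (intro cinner.tendsto P_tendsto tendsto_const)
    have "cinner (P n r) r = cinner (P n a) w" for n
      using root_inner[OF rw rw] Aw by (simp add: A_Some)
    then show "(\<lambda>n. cinner (P n r) r) \<longlonglongrightarrow> cinner a w"
      by (simp only:) (intro cinner.tendsto P_tendsto tendsto_const)
  qed
  then have "complex_of_real ((norm r)\<^sup>2 - l) = cinner (a - l *\<^sub>R w) w"
    by (simp add: cinner.diff_left cinner_scaleR_left cinner_self w)
  then have "\<bar>(norm r)\<^sup>2 - l\<bar> = cmod (cinner (a - l *\<^sub>R w) w)"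
    by (metis norm_of_real)
  also have "\<dots> \<le> e" using cinner_cauchy_schwarz[of "a - l *\<^sub>R w" w] a w by simp
  finally have "l - e \<le> (norm r)\<^sup>2" "(norm r)\<^sup>2 \<le> l + e" by linarith+
  then show ?thesis using w(1) Aw fw rw a b by blast
qed

lemma damped_operator_eigen:
  assumes "A w = Some a" "fA w = Some b" "root w = Some r"
  shows "damped_operator A E f (w, \<mu> *\<^sub>C w) = Some (\<mu> *\<^sub>C w, - (a + \<mu> *\<^sub>C b))"
  unfolding damped_operator_Some
  using assms root_scaleC[OF assms(3)]
  by (auto simp: weak_sum_iff A_Some fA_Some P_linear Op_linear lb_fs)

end

section \<open>Necessity of the two bounds\<close>

locale damped_semigroup = damped E A f
  for E :: "real set \<Rightarrow> 'h::chilbert_space \<Rightarrow> 'h" and A :: "'h \<rightharpoonup> 'h" and f :: "real \<Rightarrow> real" +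
  fixes S :: "real \<Rightarrow> 'h \<times> 'h \<Rightarrow> 'h \<times> 'h"
  assumes contraction: "contraction_semigroup (phase_space A E) (phase_norm A E) S"
    and generator: "generator (phase_space A E) (phase_norm A E) S = damped_operator A E f"
begin

sublocale carrier_semigroup "phase_space A E" "phase_norm A E" S J
  by (rule carrier_semigroupI[OF contraction])

abbreviation X :: "('h \<times> 'h) set" where "X \<equiv> phase_space A E"
abbreviation N :: "'h \<times> 'h \<Rightarrow> real" where "N \<equiv> phase_norm A E"

lemma damped_Some: "damped_operator A E f z = Some y \<longleftrightarrow> z \<in> X \<and> gv z y"
  unfolding generator[symmetric] by (rule generator_Some)

text \<open>At a time \<open>T\<close> with \<open>M * exp (- \<kappa> * T) = 1 / 2\<close> the
  rotated orbit has lost half of the norm of \<open>z\<close>. The lost half is at most the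
  increment, which \<open>rotated_increment_bound\<close> controls; hence the constant
  \<open>2 * T\<close>, independent of \<omega>.\<close>

lemma resolvent_bound:
  assumes "exponentially_stable X N S"
  shows "\<exists>C>0. \<forall>z y \<omega>. damped_operator A E f z = Some y \<longrightarrow>
    N z \<le> C * N (y - (\<i> * complex_of_real \<omega>) *\<^sub>C z)"
proof -
  obtain \<kappa> M where \<kappa>: "\<kappa> > 0" "M \<ge> 1"
    and dec: "\<And>z t. z \<in> X \<Longrightarrow> t \<ge> 0 \<Longrightarrow> N (S t z) \<le> M * exp (- \<kappa> * t) * N z"
    using assms by (auto simp: exponentially_stable_def)
  define T where "T = ln (2 * M) / \<kappa>"
  have T: "T > 0" using \<kappa> by (simp add: T_def)
  have half: "M * exp (- \<kappa> * T) = 1 / 2"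
    using \<kappa> by (simp add: T_def exp_minus field_simps)
  have "N z \<le> (2 * T) * N (y - (\<i> * complex_of_real \<omega>) *\<^sub>C z)"
    if "damped_operator A E f z = Some y" for z y \<omega>
  proof -
    have z: "z \<in> X" and gv: "gv z y" using that by (simp_all add: damped_Some)
    let ?s = "cis (- \<omega> * T) *\<^sub>C S T z"
    have s: "?s \<in> X" using z T by simp
    have "N z = norm (J ?s - J (?s - z))" using s z by (simp add: N_J J_diff)
    also have "\<dots> \<le> N ?s + N (?s - z)" using s z norm_triangle_ineq4[of "J ?s"] by (simp add: N_J)
    also have "N ?s \<le> 1 / 2 * N z"
      using dec[OF z, of T] T z unfolding half by (simp add: N_scaleC)
    also have "N (?s - z) \<le> T * N (y - (\<i> * complex_of_real \<omega>) *\<^sub>C z)"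
      by (rule rotated_increment_bound[OF z gv T])
    finally show ?thesis by simp
  qed
  then show ?thesis using T by (intro exI[of _ "2 * T"]) auto
qed

lemma N_Pair: "root u = Some a \<Longrightarrow> N (u, v) = sqrt ((norm a)\<^sup>2 + (norm v)\<^sup>2)"
  by (rule phase_norm_eq)

lemma stable_imp_bounds:
  assumes "exponentially_stable X N S"
  shows "\<exists>\<alpha>>0. \<exists>\<beta>. \<forall>l\<in>spec. \<alpha> \<le> f l \<and> f l / l \<le> \<beta>"
proof -
  obtain C where C: "C > 0" and bound: "\<And>z y \<omega>. damped_operator A E f z = Some y \<Longrightarrow>
      N z \<le> C * N (y - (\<i> * complex_of_real \<omega>) *\<^sub>C z)"
    using resolvent_bound[OF assms] by blast
  have low: "1 / C \<le> f l" if l: "l \<in> spec" for l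
  proof -
    define \<omega> where "\<omega> = sqrt l"
    have \<omega>: "\<omega> > 0" "\<omega> * \<omega> = l" using spec_pos[OF l] by (simp_all add: \<omega>_def)
    have "\<omega> - C * \<omega> * f l \<le> (C * (1 + \<omega>)) * e" if e: "0 < e" for e
    proof -
      obtain w a b r where w: "norm w = 1" "A w = Some a" "fA w = Some b" "root w = Some r"
        "norm (a - l *\<^sub>R w) \<le> e" "norm (b - f l *\<^sub>R w) \<le> e"
        using approximate_eigenvector[OF l e] by blast
      let ?\<mu> = "\<i> * complex_of_real \<omega>"
      let ?y = "(a - l *\<^sub>R w) + ?\<mu> *\<^sub>C b"
      have "?\<mu> *\<^sub>C ?\<mu> *\<^sub>C w = - (l *\<^sub>R w)"
        by (simp add: scaleC_scaleC \<omega>(2)[symmetric] scaleC_of_real[symmetric] scaleC_minus_left[symmetric]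
            algebra_simps)
      \<comment> \<open>The first components cancel exactly. In the second, \<open>\<mu>\<close>
        applied twice gives \<open>- l w\<close>, which cancels the stiffness up to \<open>e\<close>
        and leaves a damping term of size about \<open>\<omega> * f l\<close>.\<close>
      then have eq: "(?\<mu> *\<^sub>C w, - (a + ?\<mu> *\<^sub>C b)) - ?\<mu> *\<^sub>C (w, ?\<mu> *\<^sub>C w) = (0, - ?y)"
        by (simp add: scaleC_prod_def)
      have "\<omega> \<le> N (w, ?\<mu> *\<^sub>C w)"
        unfolding N_Pair[OF w(4)] using \<omega> w(1) by (intro real_le_rsqrt) (simp add: norm_scaleC norm_mult)
      also have "\<dots> \<le> C * N (0, - ?y)"
        using bound[OF damped_operator_eigen[OF w(2-4)], of ?\<mu> \<omega>] unfolding eq .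
      also have "N (0, - ?y) = norm ?y" unfolding N_Pair[OF root_zero] by (simp only: norm_minus_cancel) simp
      also have "norm ?y \<le> e + \<omega> * (f l + e)"
      proof (rule norm_triangle_le[OF add_mono[OF w(5)]])
        have "norm b \<le> norm (b - f l *\<^sub>R w) + norm (f l *\<^sub>R w)"
          using norm_triangle_sub[of b "f l *\<^sub>R w"] by simp
        also have "\<dots> \<le> f l + e" using w f_nonneg[OF l] by simp
        finally show "norm (?\<mu> *\<^sub>C b) \<le> \<omega> * (f l + e)"
          using \<omega> by (simp add: norm_scaleC norm_mult)
      qed
      finally show ?thesis using C by (simp add: algebra_simps)
    qed
    then have "\<omega> - C * \<omega> * f l \<le> 0" by (rule le_zero_of_small_multiples[of 1, rotated]) simp_all
    then have "\<omega> * 1 \<le> \<omega> * (C * f l)" by (simp add: algebra_simps)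
    then have "1 \<le> C * f l" using \<omega>(1) by (simp only: mult_le_cancel_left_pos)
    then show ?thesis using C by (simp add: field_simps)
  qed
  have up: "f l / l \<le> C" if l: "l \<in> spec" for l
  proof (rule ccontr)
    assume "\<not> f l / l \<le> C"
    have fl: "f l > 0" using low[OF l] C by (smt (verit) divide_pos_pos)
    have l0: "l > 0" by (rule spec_pos[OF l])
    \<comment> \<open>With \<open>m * f l = l\<close>, stiffness and damping cancel in the second
      component up to \<open>e\<close>, and the first has energy norm \<open>m * norm r\<close>. If
      \<open>C * m < 1\<close>, the resolvent bound would force \<open>norm r\<close> to vanish with
      \<open>e\<close>.\<close>
    define m where "m = l / f l"
    have m: "m > 0" "m * f l = l" using fl l0 by (simp_all add: m_def)
    have Cm: "1 - C * m > 0" using \<open>\<not> f l / l \<le> C\<close> fl l0 by (simp add: m_def field_simps)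
    \<comment> \<open>The restriction on \<open>e\<close> keeps \<open>(norm r)\<^sup>2\<close>
      above \<open>l / 2\<close>, a bound that does not shrink with \<open>e\<close>.\<close>
    have "(1 - C * m) * (sqrt l / 2) \<le> (C * (1 + m)) * e" if e: "0 < e" "e \<le> l / 2" for e
    proof -
      obtain w a b r where w: "norm w = 1" "A w = Some a" "fA w = Some b" "root w = Some r"
        "norm (a - l *\<^sub>R w) \<le> e" "norm (b - f l *\<^sub>R w) \<le> e" "l - e \<le> (norm r)\<^sup>2"
        using approximate_eigenvector[OF l e(1)] by blast
      let ?\<mu> = "complex_of_real (- m)"
      let ?y = "(a - l *\<^sub>R w) - m *\<^sub>R (b - f l *\<^sub>R w)"
      have r: "root (?\<mu> *\<^sub>C w) = Some (?\<mu> *\<^sub>C r)" by (rule root_scaleC[OF w(4)])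
      have eq: "(?\<mu> *\<^sub>C w, - (a + ?\<mu> *\<^sub>C b)) - (\<i> * complex_of_real 0) *\<^sub>C (w, ?\<mu> *\<^sub>C w) = (?\<mu> *\<^sub>C w, - ?y)"
        unfolding scaleC_of_real using m(2) by (simp add: scaleC_prod_def algebra_simps zero_prod_def[symmetric])
      have "norm r \<le> N (w, ?\<mu> *\<^sub>C w)" unfolding N_Pair[OF w(4)] by (intro real_le_rsqrt) simp
      also have "\<dots> \<le> C * N (?\<mu> *\<^sub>C w, - ?y)"
        using bound[OF damped_operator_eigen[OF w(2-4)], of ?\<mu> 0] unfolding eq .
      also have "N (?\<mu> *\<^sub>C w, - ?y) \<le> m * norm r + norm ?y"
        unfolding N_Pair[OF r] using m(1) sqrt_sum_squares_le_sum[of "m * norm r" "norm ?y"]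
        by (simp only: norm_scaleC norm_minus_cancel norm_of_real abs_minus_cancel abs_of_pos) simp
      also have "norm ?y \<le> e + m * e"
      proof (rule order_trans[OF norm_triangle_ineq4 add_mono[OF w(5)]])
        show "norm (m *\<^sub>R (b - f l *\<^sub>R w)) \<le> m * e" using m w(6) by simp
      qed
      finally have "norm r \<le> C * (m * norm r + (e + m * e))" using C by simp
      then have "(1 - C * m) * norm r \<le> (C * (1 + m)) * e" by (simp add: algebra_simps)
      moreover have "sqrt l / 2 \<le> norm r"
      proof (rule power2_le_imp_le)
        have "(sqrt l / 2)\<^sup>2 = l / 4" using l0 by (simp add: power_divide)
        then show "(sqrt l / 2)\<^sup>2 \<le> (norm r)\<^sup>2" using w(7) e(2) l0 by linarith
      qed simp
      ultimately show ?thesis using Cm by (meson mult_left_mono less_imp_le order_trans)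
    qed
    then have "(1 - C * m) * (sqrt l / 2) \<le> 0"
      by (rule le_zero_of_small_multiples[of "l / 2", rotated]) (use l0 in simp_all)
    then show False using Cm l0 by (simp add: mult_le_0_iff)
  qed
  show ?thesis
    using C low up by (intro exI[of _ "1 / C"] conjI exI[of _ C]) auto
qed

end

section \<open>Sufficiency of the two bounds\<close>

context damped_semigroup
begin

lemma quadratic_form_mono:
  assumes "locally_bounded g" "locally_bounded k" "\<And>s. s \<in> spec \<Longrightarrow> g s \<le> k s"
  shows "Re (cinner (Op n g x) x) \<le> Re (cinner (Op n k x) x)"
proof -
  have "0 \<le> Re (cinner (Phi (\<lambda>s. cut n s * k s - cut n s * g s) x) x)"
    by (intro Phi_nonneg_on bounded_borel_diff locally_bounded_cut assms(1,2))
       (use assms(3) in \<open>auto simp: indicator_def\<close>)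
  then show ?thesis
    by (simp add: Phi_diff locally_bounded_cut assms(1,2) Op_def cinner.diff_left)
qed

lemma locally_bounded_scale: "locally_bounded g \<Longrightarrow> locally_bounded (\<lambda>s. c * g s)"
  by (rule locally_bounded_times[OF bounded_locally_bounded[OF bounded_borel_const]])

lemma Op_scale: "locally_bounded g \<Longrightarrow> Op n (\<lambda>s. c * g s) x = c *\<^sub>R Op n g x"
  using Phi_scale[OF locally_bounded_cut, of g c n x] by (simp add: Op_def mult.left_commute)

text \<open>The left side is the derivative of the Lyapunov functional at \<open>(u, v)\<close> when
  the generator value there is \<open>(v, k)\<close>. The term
  \<open>\<langle>fA v, u\<rangle>\<close> makes sense only after truncation, so the estimate is
  shown for each \<open>n\<close> with constants independent of \<open>n\<close>.\<close>

lemma lyapunov_dissipation: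
  assumes \<alpha>: "\<And>s. s \<in> spec \<Longrightarrow> \<alpha> \<le> f s" and \<beta>: "\<And>s. s \<in> spec \<Longrightarrow> f s \<le> \<beta> * s" "\<beta> > 0"
    and \<epsilon>: "0 < \<epsilon>" "\<epsilon> * \<beta> \<le> 1" "4 * \<epsilon> \<le> \<alpha>"
    and a: "root u = Some a" and b: "root v = Some b"
    and k: "weak_sum A fA u v (- k)"
  shows "Re (cinner b a) + Re (cinner k v) + \<epsilon> * (Re (cinner v v) + Re (cinner k u))
    \<le> - (\<epsilon> / 2) * ((norm a)\<^sup>2 + (norm v)\<^sup>2)"
proof -
  have step: "Re (cinner (P n b) a) + Re (cinner (P n k) v)
      + \<epsilon> * (Re (cinner (P n v) v) + Re (cinner (P n k) u))
    \<le> - (\<epsilon> / 2) * ((norm (P n a))\<^sup>2 + (norm (P n v))\<^sup>2)" for n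
  proof -
    define p where "p = (norm (P n a))\<^sup>2"
    define q where "q = Re (cinner (Op n fs v) v)"
    define t where "t = Re (cinner (Op n fs v) u)"
    define y where "y = Re (cinner (Op n fs u) u)"
    define m where "m = (norm (P n v))\<^sup>2"
    \<comment> \<open>Half of \<open>q\<close> pays for \<open>d / 2\<close> and three eighths of it
      for \<open>3 * m / 2\<close>. It is used below with \<open>p\<close>, \<open>t\<close>,
      \<open>m\<close> scaled by \<epsilon> and with \<open>d = \<epsilon> * \<beta> * q\<close>;
      this fixes the conditions on \<epsilon>.\<close>
    have combine: "- q + (m - p - t) \<le> - ((p + m) / 2)"
      if "0 \<le> p + 2 * t + d" "4 * m \<le> q" "0 \<le> q" "d \<le> q" for p t d q m :: real
      using that by (simp add: field_simps)
    have lb1: "locally_bounded (\<lambda>s. 1)"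
      by (rule bounded_locally_bounded[OF bounded_borel_const])
    have P1: "Op n (\<lambda>s. 1) x = P n x" for x by (simp add: Op_def P_def)
    have m: "Re (cinner (P n v) v) = m" by (simp add: m_def P_eq_E E_quad)
    have p: "Re (cinner (Op n (\<lambda>s. s) u) u) = p"
      unfolding root_inner[OF a a, of n, symmetric] by (simp add: p_def P_eq_E E_quad)
    have "Re (cinner (Op n (\<lambda>s. \<alpha> * 1) v) v) \<le> q"
      unfolding q_def by (rule quadratic_form_mono[OF locally_bounded_scale[OF lb1] lb_fs])
        (use \<alpha> in \<open>auto simp: fs_def\<close>)
    then have mq: "\<alpha> * m \<le> q"
      unfolding Op_scale[OF lb1] P1 by (simp add: cinner_scaleR_left m)
    have "y \<le> Re (cinner (Op n (\<lambda>s. \<beta> * s) u) u)"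
      unfolding y_def by (rule quadratic_form_mono[OF lb_fs locally_bounded_scale[OF locally_bounded_id]])
        (use \<beta>(1) in \<open>auto simp: fs_def\<close>)
    then have yp: "y \<le> \<beta> * p"
      unfolding Op_scale[OF locally_bounded_id] by (simp add: cinner_scaleR_left p)
    \<comment> \<open>Nonnegativity at \<open>u + \<beta> v\<close> bounds the cross term
      \<open>t\<close> from below; the bound \<open>y \<le> \<beta> * p\<close> and division by
      \<beta> then replace the \<open>u\<close> part by the potential energy
      \<open>p\<close>.\<close>
    have "0 \<le> Re (cinner (Op n fs (u + \<beta> *\<^sub>R v)) (u + \<beta> *\<^sub>R v))"
      unfolding Op_def by (intro Phi_nonneg_on locally_bounded_cut lb_fs)
        (use f_nonneg in \<open>auto simp: fs_def\<close>)
    moreover have "Re (cinner (Op n fs u) v) = t"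
      unfolding t_def by (metis Op_sym cinner_commute complex_cnj lb_fs complex.sel(1) cnj.sel(1))
    ultimately have "0 \<le> y + 2 * \<beta> * t + \<beta>\<^sup>2 * q"
      by (simp add: Op_linear lb_fs cinner_add_left cinner_add_right cinner_scaleR_left
          cinner_scaleR_right y_def t_def q_def power2_eq_square algebra_simps)
    then have "0 \<le> \<beta> * (p + 2 * t + \<beta> * q)"
      using yp by (simp add: power2_eq_square algebra_simps)
    then have "0 \<le> p + 2 * t + \<beta> * q"
      using \<beta>(2) by (simp add: zero_le_mult_iff)
    then have "0 \<le> \<epsilon> * (p + 2 * t + \<beta> * q)" using \<epsilon>(1) by simp
    then have "0 \<le> \<epsilon> * p + 2 * (\<epsilon> * t) + \<epsilon> * \<beta> * q" by (simp add: algebra_simps)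
    moreover have m0: "0 \<le> m" by (simp add: m_def)
    moreover have "4 * (\<epsilon> * m) \<le> q"
      using mult_right_mono[OF \<epsilon>(3) m0] mq by simp
    moreover have q0: "0 \<le> q" unfolding q_def Op_def
      by (intro Phi_nonneg_on locally_bounded_cut lb_fs) (use f_nonneg in \<open>auto simp: fs_def\<close>)
    moreover have "\<epsilon> * \<beta> * q \<le> q" using mult_right_mono[OF \<epsilon>(2) q0] by simp
    ultimately have "- q + (\<epsilon> * m - \<epsilon> * p - \<epsilon> * t) \<le> - ((\<epsilon> * p + \<epsilon> * m) / 2)"
      using combine[of "\<epsilon> * p" "\<epsilon> * t" "\<epsilon> * \<beta> * q" "\<epsilon> * m" q] by blast
    then have main: "- q + \<epsilon> * (m - p - t) \<le> - (\<epsilon> / 2) * (p + m)"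
      by (simp add: algebra_simps)
    have Pk: "P n k = - (Op n (\<lambda>s. s) u + Op n fs v)"
      using k P_linear(6)[of n k] by (simp add: weak_sum_iff)
    \<comment> \<open>This term cancels the \<open>A\<close> part of
      \<open>Re (cinner (P n k) v)\<close>, so the energy derivative reduces to
      \<open>- q\<close>.\<close>
    have Pb: "Re (cinner (P n b) a) = Re (cinner (Op n (\<lambda>s. s) u) v)"
      unfolding root_inner[OF a b] by (metis Op_sym cinner_commute locally_bounded_id cnj.sel(1))
    have "Re (cinner (P n b) a) + Re (cinner (P n k) v)
        + \<epsilon> * (Re (cinner (P n v) v) + Re (cinner (P n k) u)) = - q + \<epsilon> * (m - p - t)"
      unfolding Pb Pk m
      by (simp only: cinner.minus_left cinner_add_left uminus_complex.sel plus_complex.sel p q_def t_def)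
         simp
    then show ?thesis using main by (simp add: p_def m_def)
  qed
  show ?thesis
  proof (rule LIMSEQ_le[OF _ _ exI[of _ 0]])
    show "(\<lambda>n. Re (cinner (P n b) a) + Re (cinner (P n k) v)
        + \<epsilon> * (Re (cinner (P n v) v) + Re (cinner (P n k) u)))
      \<longlonglongrightarrow> Re (cinner b a) + Re (cinner k v) + \<epsilon> * (Re (cinner v v) + Re (cinner k u))"
      by (intro tendsto_intros cinner.tendsto P_tendsto)
    show "(\<lambda>n. - (\<epsilon> / 2) * ((norm (P n a))\<^sup>2 + (norm (P n v))\<^sup>2))
      \<longlonglongrightarrow> - (\<epsilon> / 2) * ((norm a)\<^sup>2 + (norm v)\<^sup>2)"
      by (intro tendsto_intros P_tendsto)
  qed (use step in auto)
qed

text \<open>The functional \<open>V\<close> lies between a quarter of the squared norm and the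
  squared norm, and decays at rate \<open>\<epsilon> / 2\<close>. Square roots turn the quarter into
  the factor 2 and the rate into \<open>\<epsilon> / 4\<close>.\<close>

lemma decay_on_domain:
  assumes \<alpha>: "\<And>s. s \<in> spec \<Longrightarrow> \<alpha> \<le> f s" and \<beta>: "\<And>s. s \<in> spec \<Longrightarrow> f s \<le> \<beta> * s" "\<beta> > 0"
    and \<epsilon>: "0 < \<epsilon>" "\<epsilon> * \<beta> \<le> 1" "4 * \<epsilon> \<le> \<alpha>"
    and Q: "bounded_linear Q" "\<And>u a. root u = Some a \<Longrightarrow> Q a = u"
    and K: "\<And>a. norm (Q a) \<le> norm a * K" "2 * \<epsilon> * K \<le> 1"
    and z: "z \<in> X" "gv z y" and t: "0 \<le> t"
  shows "N (S t z) \<le> 2 * exp (- (\<epsilon> / 4) * t) * N z"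
proof -
  define V where "V s = (1 / 2) * (norm (J (S s z)))\<^sup>2 + \<epsilon> * Re (cinner (fst (S s z)) (snd (S s z)))" for s
  have dom: "root (fst (S s z)) = Some (fst (J (S s z)))" "S s z \<in> X" if "s \<ge> 0" for s
    using S_X[OF that z(1)] phase_space_iff[of "S s z"] by (auto simp: J_def)
  \<comment> \<open>\<open>K\<close> bounds the norm of \<open>u\<close> by its energy norm;
    \<open>2 * \<epsilon> * K \<le> 1\<close> and the inequality of the means leave a quarter of the
    squared norm.\<close>
  have cross: "\<bar>\<epsilon> * Re (cinner (fst (S s z)) (snd (S s z)))\<bar> \<le> 1 / 4 * (norm (J (S s z)))\<^sup>2"
    if s: "s \<ge> 0" for s
  proof -
    let ?u = "fst (S s z)" and ?v = "snd (S s z)" and ?a = "fst (J (S s z))"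
    have "\<bar>\<epsilon> * Re (cinner ?u ?v)\<bar> \<le> \<epsilon> * (norm ?u * norm ?v)"
      using \<epsilon>(1) abs_Re_le_cmod[of "cinner ?u ?v"] cinner_cauchy_schwarz[of ?u ?v]
      by (simp add: abs_mult)
    also have "\<dots> \<le> \<epsilon> * ((norm ?a * K) * norm ?v)"
      using K(1)[of ?a] Q(2)[OF dom(1)[OF s]] \<epsilon>(1) by (intro mult_left_mono mult_right_mono) auto
    also have "\<dots> = (\<epsilon> * K) * (norm ?a * norm ?v)" by simp
    also have "\<dots> \<le> (1 / 2) * (norm ?a * norm ?v)" using K(2) by (intro mult_right_mono) auto
    also have "\<dots> \<le> 1 / 4 * ((norm ?a)\<^sup>2 + (norm ?v)\<^sup>2)"
      using sum_squares_bound[of "norm ?a" "norm ?v"] by (simp add: mult_ac)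
    also have "(norm ?a)\<^sup>2 + (norm ?v)\<^sup>2 = (norm (J (S s z)))\<^sup>2"
      by (simp add: J_def norm_prod_def)
    finally show ?thesis .
  qed
  have V_lower: "1 / 4 * (norm (J (S s z)))\<^sup>2 \<le> V s" and V_upper: "V s \<le> (norm (J (S s z)))\<^sup>2"
    if "s \<ge> 0" for s
    using cross[OF that] zero_le_power2[of "norm (J (S s z))"] unfolding V_def by linarith+
  have V_deriv: "\<exists>D. (V has_real_derivative D) (at s within {0..}) \<and> D \<le> - (\<epsilon> / 2) * V s"
    if s: "s \<ge> 0" for s
  proof -
    let ?u = "fst (S s z)" and ?v = "snd (S s z)" and ?a = "fst (J (S s z))"
    let ?b = "fst (J (S s y))" and ?k = "snd (S s y)"
    have J: "((\<lambda>s. J (S s z)) has_vector_derivative J (S s y)) (at s within {0..})"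
      by (rule S_vector_derivative[OF z s])
    have da: "((\<lambda>s. fst (J (S s z))) has_vector_derivative ?b) (at s within {0..})"
      by (rule bounded_linear.has_vector_derivative[OF bounded_linear_fst J])
    have dv: "((\<lambda>s. snd (S s z)) has_vector_derivative ?k) (at s within {0..})"
      using bounded_linear.has_vector_derivative[OF bounded_linear_snd J] by (simp add: J_def)
    \<comment> \<open>The derivative is known only in the coordinates \<open>J\<close>; the bounded
      left inverse \<open>Q\<close> of the square root yields that of the first component.\<close>
    have "((\<lambda>s. Q (fst (J (S s z)))) has_vector_derivative Q ?b) (at s within {0..})"
      by (rule bounded_linear.has_vector_derivative[OF Q(1) da])
    moreover have y: "y \<in> X" using gvD(1)[OF z(2)] .
    then have b: "root (fst (S s y)) = Some ?b"
      using S_X[OF s y] phase_space_iff[of "S s y"] by (auto simp: J_def)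
    ultimately have "((\<lambda>s. Q (fst (J (S s z)))) has_vector_derivative fst (S s y)) (at s within {0..})"
      using Q(2) by simp
    then have du: "((\<lambda>s. fst (S s z)) has_vector_derivative fst (S s y)) (at s within {0..})"
      by (rule has_vector_derivative_transform[rotated 2]) (use s in \<open>simp_all add: Q(2)[OF dom(1)]\<close>)
    have "damped_operator A E f (S s z) = Some (S s y)"
      unfolding damped_Some using dom(2)[OF s] gv_S[OF z s] by simp
    then have "damped_operator A E f (?u, ?v) = Some (fst (S s y), ?k)" by simp
    then have fy: "fst (S s y) = ?v" and k: "weak_sum A fA ?u ?v (- ?k)"
      by (simp_all only: damped_operator_Some)
    have sq: "V s = (1 / 2) * (Re (cinner (fst (J (S s z))) (fst (J (S s z)))) + Re (cinner (snd (S s z)) (snd (S s z))))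
        + \<epsilon> * Re (cinner (fst (S s z)) (snd (S s z)))" for s
      by (simp add: V_def cinner_self J_def norm_prod_def)
    let ?D = "(1 / 2) * (Re (cinner ?a ?b + cinner ?b ?a) + Re (cinner ?v ?k + cinner ?k ?v))
        + \<epsilon> * Re (cinner ?u ?k + cinner ?v ?v)"
    have "(V has_vector_derivative ?D) (at s within {0..})"
      unfolding sq[abs_def]
      by (intro has_vector_derivative_add bounded_linear.has_vector_derivative[OF bounded_linear_mult_right]
          bounded_linear.has_vector_derivative[OF bounded_linear_Re] cinner.has_vector_derivative
          da dv du[unfolded fy])
    moreover have "Re (cinner x w) = Re (cinner w x)" for x w :: 'h
      by (metis cinner_commute cnj.sel(1))
    then have "?D = Re (cinner ?b ?a) + Re (cinner ?k ?v) + \<epsilon> * (Re (cinner ?v ?v) + Re (cinner ?k ?u))"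
      by (simp add: algebra_simps)
    moreover have "\<dots> \<le> - (\<epsilon> / 2) * ((norm ?a)\<^sup>2 + (norm ?v)\<^sup>2)"
      by (rule lyapunov_dissipation[OF \<alpha> \<beta> \<epsilon> dom(1)[OF s] b[unfolded fy] k])
    moreover have "(norm ?a)\<^sup>2 + (norm ?v)\<^sup>2 = (norm (J (S s z)))\<^sup>2"
      by (simp add: J_def norm_prod_def)
    moreover have "- (\<epsilon> / 2) * (norm (J (S s z)))\<^sup>2 \<le> - (\<epsilon> / 2) * V s"
      using V_upper[OF s] \<epsilon>(1) by (intro mult_left_mono_neg) auto
    ultimately show ?thesis
      by (intro exI[of _ ?D]) (simp add: has_real_derivative_iff_has_vector_derivative)
  qed
  \<comment> \<open>Integrating factor for the differential inequality of \<open>V\<close>.\<close>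
  define W where "W s = exp (\<epsilon> / 2 * s) * V s" for s
  have W_deriv: "\<exists>D. (W has_real_derivative D) (at s within {0..}) \<and> D \<le> 0" if s: "s \<ge> 0" for s
  proof -
    obtain D where D: "(V has_real_derivative D) (at s within {0..})" "D \<le> - (\<epsilon> / 2) * V s"
      using V_deriv[OF s] by blast
    have "(W has_real_derivative exp (\<epsilon> / 2 * s) * (\<epsilon> / 2 * V s + D)) (at s within {0..})"
      unfolding W_def by (auto intro!: derivative_eq_intros D(1) simp: algebra_simps)
    moreover have "exp (\<epsilon> / 2 * s) * (\<epsilon> / 2 * V s + D) \<le> 0"
      using D(2) by (intro mult_nonneg_nonpos) auto
    ultimately show ?thesis by blast
  qed
  have "W t \<le> W 0"
  proof (rule DERIV_nonpos_imp_decreasing_open[OF t])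
    fix s :: real assume "0 < s"
    then have "at s within {0..} = at s" by (intro at_within_interior) simp
    then show "\<exists>D. (W has_real_derivative D) (at s) \<and> D \<le> 0" using W_deriv[of s] \<open>0 < s\<close> by simp
  next
    show "continuous_on {0..t} W"
      unfolding continuous_on_eq_continuous_within
    proof
      fix s assume s: "s \<in> {0..t}"
      then obtain D where "(W has_real_derivative D) (at s within {0..})" using W_deriv[of s] by auto
      then have "continuous (at s within {0..}) W" by (rule DERIV_continuous)
      then show "continuous (at s within {0..t}) W" by (rule continuous_within_subset) auto
    qed
  qed
  also have "W 0 \<le> (norm (J z))\<^sup>2" using V_upper[of 0] z(1) by (simp add: W_def S_zero)
  finally have "exp (\<epsilon> / 2 * t) * V t \<le> (norm (J z))\<^sup>2" by (simp add: W_def)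
  moreover have "exp (\<epsilon> / 2 * t) * (1 / 4 * (norm (J (S t z)))\<^sup>2) \<le> exp (\<epsilon> / 2 * t) * V t"
    using V_lower[OF t] by (intro mult_left_mono) auto
  ultimately have "exp (\<epsilon> / 2 * t) * (1 / 4 * (norm (J (S t z)))\<^sup>2) \<le> (norm (J z))\<^sup>2"
    by linarith
  then have "exp (\<epsilon> / 2 * t) * (1 / 4 * (N (S t z))\<^sup>2) \<le> (N z)\<^sup>2"
    using z(1) t by (simp add: N_J)
  moreover have "exp (\<epsilon> / 2 * t) = (exp (\<epsilon> / 4 * t))\<^sup>2"
    by (simp add: exp_double[symmetric])
  ultimately have "(exp (\<epsilon> / 4 * t) * N (S t z))\<^sup>2 \<le> (2 * N z)\<^sup>2"
    by (simp add: power_mult_distrib)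
  then have "exp (\<epsilon> / 4 * t) * N (S t z) \<le> 2 * N z"
    by (rule power2_le_imp_le) (use z(1) in \<open>simp add: N_nonneg\<close>)
  then show ?thesis by (simp add: exp_minus field_simps)
qed

text \<open>Truncating both components enters every domain at once, and truncation commutes with the
  square root, so convergence holds in the energy norm.\<close>

lemma domain_dense:
  assumes "z \<in> X"
  shows "\<exists>zn. (\<forall>n. zn n \<in> X \<and> (\<exists>y. gv (zn n) y)) \<and> (\<lambda>n. J (zn n)) \<longlonglongrightarrow> J z"
proof (intro exI[of _ "\<lambda>n. (P n (fst z), P n (snd z))"] conjI allI)
  fix n
  have "weak_sum A fA (P n (fst z)) (P n (snd z)) (- (- (Op n (\<lambda>s. s) (fst z) + Op n fs (snd z))))"
    using A_P[of n "fst z"] fA_P[of n "snd z"] by (simp add: weak_sum_iff A_Some fA_Some P_linear)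
  then have "damped_operator A E f (P n (fst z), P n (snd z))
      = Some (P n (snd z), - (Op n (\<lambda>s. s) (fst z) + Op n fs (snd z)))"
    by (simp only: damped_operator_Some) (auto simp: root_P)
  then show "(P n (fst z), P n (snd z)) \<in> X" "\<exists>y. gv (P n (fst z), P n (snd z)) y"
    by (auto simp: damped_Some)
next
  obtain a where a: "root (fst z) = Some a" using assms by (auto simp: phase_space_iff)
  then have "J (P n (fst z), P n (snd z)) = (P n a, P n (snd z))" for n
    by (simp add: J_def root_P root_Some)
  then show "(\<lambda>n. J (P n (fst z), P n (snd z))) \<longlonglongrightarrow> J z"
    using a by (auto simp: J_def intro!: tendsto_Pair P_tendsto)
qed

lemma bounds_imp_stable:
  assumes "\<alpha> > 0" and bounds: "\<And>l. l \<in> spec \<Longrightarrow> \<alpha> \<le> f l \<and> f l / l \<le> \<beta>0"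
  shows "exponentially_stable X N S"
proof -
  obtain Q where Q: "bounded_linear Q" "\<And>u a. root u = Some a \<Longrightarrow> Q a = u"
    using root_left_inverse by blast
  obtain K where K: "K > 0" "\<And>a. norm (Q a) \<le> norm a * K"
    using bounded_linear.pos_bounded[OF Q(1)] by blast
  \<comment> \<open>The maximum with 1 makes \<beta> positive whatever \<open>\<beta>0\<close> is,
    as division by \<beta> requires.\<close>
  define \<beta> where "\<beta> = max \<beta>0 1"
  \<comment> \<open>One entry per requirement: absorbing the cross term with \<open>f\<close>,
    letting the damping dominate the velocity, and equivalence of the functional with the
    energy.\<close>
  define \<epsilon> where "\<epsilon> = Min {1 / \<beta>, \<alpha> / 4, 1 / (2 * K)}"
  have \<beta>: "\<beta> > 0" "f s \<le> \<beta> * s" if "s \<in> spec" for s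
  proof -
    show "\<beta> > 0" by (simp add: \<beta>_def)
    have "f s / s \<le> \<beta>" using bounds[OF that] by (simp add: \<beta>_def le_max_iff_disj)
    then show "f s \<le> \<beta> * s" using spec_pos[OF that] by (simp add: pos_divide_le_eq)
  qed
  have \<beta>0: "\<beta> > 0" by (simp add: \<beta>_def)
  have "\<epsilon> > 0" using \<beta>0 K(1) assms(1) by (simp add: \<epsilon>_def)
  moreover have "\<epsilon> \<le> 1 / \<beta>" "\<epsilon> \<le> \<alpha> / 4" "\<epsilon> \<le> 1 / (2 * K)" by (simp_all add: \<epsilon>_def)
  ultimately have \<epsilon>: "\<epsilon> > 0" "\<epsilon> * \<beta> \<le> 1" "4 * \<epsilon> \<le> \<alpha>" "2 * \<epsilon> * K \<le> 1"
    using \<beta>0 K(1) by (simp_all add: field_simps)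
  have dec: "N (S t z) \<le> 2 * exp (- (\<epsilon> / 4) * t) * N z" if z: "z \<in> X" and t: "0 \<le> t" for z t
  proof -
    let ?e = "2 * exp (- (\<epsilon> / 4) * t)"
    obtain zn where zn: "\<And>n. zn n \<in> X" "\<And>n. \<exists>y. gv (zn n) y" and lim: "(\<lambda>n. J (zn n)) \<longlonglongrightarrow> J z"
      using domain_dense[OF z] by blast
    \<comment> \<open>Contractivity controls the part \<open>z - zn n\<close>, so the decay estimate
      extends from the dense domain with the same constants.\<close>
    have "N (S t z) \<le> ?e * N (zn n) + N (z - zn n)" for n
    proof -
      obtain y where y: "gv (zn n) y" using zn(2) by blast
      have "S t z = S t (zn n) + S t (z - zn n)" using S_add[OF t zn(1), of "z - zn n" n] z zn(1) by simp
      then have "N (S t z) \<le> N (S t (zn n)) + N (S t (z - zn n))"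
        using N_triangle[of "S t (zn n)" "S t (z - zn n)"] z zn(1) t by simp
      moreover have "N (S t (zn n)) \<le> ?e * N (zn n)"
        using bounds by (intro decay_on_domain[OF _ \<beta>(2) \<beta>0 \<epsilon>(1-3) Q K(2) \<epsilon>(4) zn(1) y t]) auto
      moreover have "N (S t (z - zn n)) \<le> N (z - zn n)" using z zn(1) t by (simp add: S_N_le)
      ultimately show ?thesis by simp
    qed
    then have "N (S t z) \<le> ?e * norm (J (zn n)) + norm (J z - J (zn n))" for n
      using z zn(1) by (simp add: N_J J_diff)
    moreover have "(\<lambda>n. ?e * norm (J (zn n)) + norm (J z - J (zn n))) \<longlonglongrightarrow> ?e * norm (J z) + norm (J z - J z)"
      by (intro tendsto_intros lim)
    ultimately have "N (S t z) \<le> ?e * norm (J z) + norm (J z - J z)"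
      by (intro LIMSEQ_le_const) auto
    then show ?thesis using z by (simp add: N_J)
  qed
  show ?thesis
    unfolding exponentially_stable_def
    by (rule exI[of _ "\<epsilon> / 4"], rule conjI, use \<epsilon>(1) in simp, rule exI[of _ 2]) (use dec in auto)
qed

end

section \<open>The equivalence\<close>

theorem theorem10p1:
  fixes A :: "'h::chilbert_space \<rightharpoonup> 'h"
    and E :: "real set \<Rightarrow> 'h \<Rightarrow> 'h"
    and f :: "real \<Rightarrow> real"
    and S :: "real \<Rightarrow> 'h \<times> 'h \<Rightarrow> 'h \<times> 'h"
  assumes "separable_space (euclidean :: 'h topology)"
    and "selfadjoint_op A"
    and "strictly_positive_op A"
    and "is_spectral_measure_of E A"
    and "continuous_on (real_spectrum A) f"
    and "\<forall>s\<in>real_spectrum A. 0 \<le> f s"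
    and "contraction_semigroup (phase_space A E) (phase_norm A E) S"
    and "generator (phase_space A E) (phase_norm A E) S = damped_operator A E f"
  shows "exponentially_stable (phase_space A E) (phase_norm A E) S \<longleftrightarrow>
    (INF s\<in>real_spectrum A. ereal (f s)) > 0 \<and>
    (SUP s\<in>real_spectrum A. ereal (f s / s)) < \<infinity>"
proof -
  interpret damped_semigroup E A f S
    using assms(3-8) by unfold_locales (auto simp: is_spectral_measure_of_def)
  show ?thesis
  proof
    assume "exponentially_stable (phase_space A E) (phase_norm A E) S"
    then obtain \<alpha> \<beta> where \<alpha>: "\<alpha> > 0" and b: "\<And>l. l \<in> spec \<Longrightarrow> \<alpha> \<le> f l" "\<And>l. l \<in> spec \<Longrightarrow> f l / l \<le> \<beta>"
      using stable_imp_bounds by blast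
    have "0 < ereal \<alpha>" using \<alpha> by simp
    also have "ereal \<alpha> \<le> (INF s\<in>spec. ereal (f s))" by (rule INF_greatest) (simp add: b)
    finally have 1: "(INF s\<in>spec. ereal (f s)) > 0" .
    have "(SUP s\<in>spec. ereal (f s / s)) \<le> ereal \<beta>" by (rule SUP_least) (simp add: b)
    also have "\<dots> < \<infinity>" by simp
    finally show "(INF s\<in>spec. ereal (f s)) > 0 \<and> (SUP s\<in>spec. ereal (f s / s)) < \<infinity>" using 1 by simp
  next
    assume "(INF s\<in>spec. ereal (f s)) > 0 \<and> (SUP s\<in>spec. ereal (f s / s)) < \<infinity>"
    \<comment> \<open>In \<open>ereal\<close> an unbounded supremum is infinite, so both strict
      inequalities leave room for real numbers, which become the uniform constants.\<close>
    then obtain \<alpha> \<beta> where \<alpha>: "0 < ereal \<alpha>" "ereal \<alpha> < (INF s\<in>spec. ereal (f s))"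
      and \<beta>: "(SUP s\<in>spec. ereal (f s / s)) < ereal \<beta>"
      using ereal_dense2 by meson
    have "\<alpha> \<le> f l \<and> f l / l \<le> \<beta>" if "l \<in> spec" for l
    proof -
      have "ereal \<alpha> < ereal (f l)" using \<alpha>(2) INF_lower[OF that, of "\<lambda>s. ereal (f s)"] by (rule less_le_trans)
      moreover have "ereal (f l / l) < ereal \<beta>"
        using SUP_upper[OF that, of "\<lambda>s. ereal (f s / s)"] \<beta> by (rule le_less_trans)
      ultimately show ?thesis by simp
    qed
    with \<alpha>(1) show "exponentially_stable (phase_space A E) (phase_norm A E) S"
      by (intro bounds_imp_stable[of \<alpha> \<beta>]) auto
  qed
qed

end
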